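(* Let $n\ge 1$ and $l\ge 2$ be integers, let $H$ be a non-transitive subgroup of $\mathrm{Sym}_n$, let $S=S_{n,l}(H)$ and let $K$ be a field. Then $K[S]$ has exponential growth. Furthermore, if $H$ is also semi-regular and abelian, then $K[S]$ is a finitely generated free right (respectively, left) module over a finitely generated free $K$-algebra.
   Context: $\mathrm{Sym}_n$ is the symmetric group on $\{1,\dots,n\}$; a subgroup $H$ is transitive if it acts transitively on $\{1,\dots,n\}$, and semi-regular if for every $i\in\{1,\dots,n\}$ the stabilizer $H_i=\{\sigma\in H\mid \sigma(i)=i\}$ is trivial. For a subgroup $H$ of $\mathrm{Sym}_n$ and an integer $l\ge 2$, $S_{n,l}(H)$ is the monoid given by the presentation $$S_{n,l}(H)=\langle x_1,\dots ,x_n\mid x_{i_1}x_{i_2}\cdots x_{i_l} =x_{\sigma (i_1)} x_{\sigma (i_2)} \cdots x_{\sigma (i_l)},\ \sigma \in H,\ i_1,\ldots ,i_l \in \{1,\ldots ,n\}\rangle.$$ $K[S]$ denotes the monoid algebra over $K$. A finitely generated $K$-algebra $A$ has exponential growth if, for a finite-dimensional generating subspace $V$ containing $1$, the function $m\mapsto \dim_K V^m$ grows exponentially, i.e. $\limsup_m (\dim_K V^m)^{1/m}>1$. A finitely generated free $K$-algebra is a free associative (noncommutative polynomial) $K$-algebra $K\langle y_1,\dots,y_r\rangle$ of finite rank; here it is a $K$-subalgebra of $K[S]$, and the module structures on $K[S]$ are given by right (respectively, left) multiplication in $K[S]$. *)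

theory Defs
  imports
    "HOL-Algebra.Sym_Groups"
    "HOL-Algebra.QuotRing"
    "HOL-Library.Extended_Real"
    "HOL-Library.Liminf_Limsup"
    "Jordan_Normal_Form.Missing_VectorSpace"
begin

section \<open>Permutation groups\<close>

definition transitive_on :: "(nat \<Rightarrow> nat) set \<Rightarrow> nat \<Rightarrow> bool" where
  "transitive_on H n \<longleftrightarrow> (\<forall>i\<in>{1..n}. \<forall>j\<in>{1..n}. \<exists>\<sigma>\<in>H. \<sigma> i = j)"

definition semi_regular :: "(nat \<Rightarrow> nat) set \<Rightarrow> nat \<Rightarrow> bool" where
  "semi_regular H n \<longleftrightarrow> (\<forall>i\<in>{1..n}. {\<sigma>\<in>H. \<sigma> i = i} = {id})"


section \<open>Monoids given by presentations\<close>

text \<open>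
  The congruence on the free monoid of words over the alphabet \<open>X\<close> (words are lists, the
  product is concatenation) generated by a set \<open>R\<close> of pairs of words. Pairs in \<open>R\<close> that are
  not pairs of words over \<open>X\<close> are ignored.
\<close>

inductive_set word_cong :: "'a set \<Rightarrow> ('a list \<times> 'a list) set \<Rightarrow> ('a list \<times> 'a list) set"
  for X :: "'a set" and R :: "('a list \<times> 'a list) set" where
  base: "(u, v) \<in> R \<Longrightarrow> u \<in> lists X \<Longrightarrow> v \<in> lists X \<Longrightarrow> (u, v) \<in> word_cong X R"
| refl: "u \<in> lists X \<Longrightarrow> (u, u) \<in> word_cong X R"
| sym: "(u, v) \<in> word_cong X R \<Longrightarrow> (v, u) \<in> word_cong X R"
| trans: "(u, v) \<in> word_cong X R \<Longrightarrow> (v, w) \<in> word_cong X R \<Longrightarrow> (u, w) \<in> word_cong X R"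
| mult: "(u, v) \<in> word_cong X R \<Longrightarrow> (u', v') \<in> word_cong X R \<Longrightarrow>
    (u @ u', v @ v') \<in> word_cong X R"

definition presented_monoid :: "'a set \<Rightarrow> ('a list \<times> 'a list) set \<Rightarrow> 'a list set monoid" where
  "presented_monoid X R =
    \<lparr>carrier = lists X // word_cong X R,
     mult = (\<lambda>A B. \<Union>u\<in>A. \<Union>v\<in>B. word_cong X R `` {u @ v}),
     one = word_cong X R `` {[]}\<rparr>"

definition perm_rels :: "nat \<Rightarrow> nat \<Rightarrow> (nat \<Rightarrow> nat) set \<Rightarrow> (nat list \<times> nat list) set" where
  "perm_rels n l H = {(w, map \<sigma> w) | w \<sigma>. w \<in> lists {1..n} \<and> length w = l \<and> \<sigma> \<in> H}"

text \<open>The monoid \<open>S\<^sub>n\<^sub>,\<^sub>l(H)\<close>; the generator \<open>x\<^sub>i\<close> is the class of the word \<open>[i]\<close>.\<close>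

definition perm_monoid :: "nat \<Rightarrow> nat \<Rightarrow> (nat \<Rightarrow> nat) set \<Rightarrow> nat list set monoid" where
  "perm_monoid n l H = presented_monoid {1..n} (perm_rels n l H)"

definition free_monoid :: "'a set \<Rightarrow> 'a list monoid" where
  "free_monoid X = \<lparr>carrier = lists X, mult = (@), one = []\<rparr>"

lemma word_cong_lists: "(u, v) \<in> word_cong X R \<Longrightarrow> u \<in> lists X \<and> v \<in> lists X"
  by (induction rule: word_cong.induct) auto

lemma equiv_word_cong: "equiv (lists X) (word_cong X R)"
proof (rule equivI)
  show "word_cong X R \<subseteq> lists X \<times> lists X"
    using word_cong_lists by fast
  show "refl_on (lists X) (word_cong X R)"
    by (auto intro!: refl_onI word_cong.refl)
  show "sym (word_cong X R)"
    by (auto intro!: symI word_cong.sym)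
  show "trans (word_cong X R)"
    by (blast intro: transI word_cong.trans)
qed

lemma presented_monoid_mult_class:
  assumes "u \<in> lists X" "v \<in> lists X"
  shows "word_cong X R `` {u} \<otimes>\<^bsub>presented_monoid X R\<^esub> word_cong X R `` {v} =
    word_cong X R `` {u @ v}"
proof -
  have eq: "word_cong X R `` {u' @ v'} = word_cong X R `` {u @ v}"
    if "(u, u') \<in> word_cong X R" "(v, v') \<in> word_cong X R" for u' v'
    using equiv_class_eq[OF equiv_word_cong word_cong.mult[OF that]] by simp
  have "(u, u) \<in> word_cong X R" "(v, v) \<in> word_cong X R"
    using assms by (auto intro: word_cong.refl)
  then have "(\<Union>u'\<in>word_cong X R `` {u}. \<Union>v'\<in>word_cong X R `` {v}. word_cong X R `` {u' @ v'}) =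
      word_cong X R `` {u @ v}"
    using eq by fast
  then show ?thesis
    unfolding presented_monoid_def by simp
qed

lemma monoid_presented_monoid: "monoid (presented_monoid X R)" (is "monoid ?M")
proof -
  have car: "\<exists>u\<in>lists X. a = word_cong X R `` {u}" if "a \<in> carrier ?M" for a
    using that unfolding presented_monoid_def by (auto elim!: quotientE)
  have cls: "word_cong X R `` {u} \<in> carrier ?M" if "u \<in> lists X" for u
    using that unfolding presented_monoid_def by (auto intro: quotientI)
  have one: "\<one>\<^bsub>?M\<^esub> = word_cong X R `` {[]}"
    unfolding presented_monoid_def by simp
  have app: "u @ v \<in> lists X" if "u \<in> lists X" "v \<in> lists X" for u v
    using that by auto
  have nil: "[] \<in> lists X"
    by simp
  show ?thesis
  proof (rule monoidI)
    fix a b assume "a \<in> carrier ?M" "b \<in> carrier ?M"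
    then obtain u v where uv: "u \<in> lists X" "v \<in> lists X"
      and "a = word_cong X R `` {u}" "b = word_cong X R `` {v}"
      using car by metis
    then show "a \<otimes>\<^bsub>?M\<^esub> b \<in> carrier ?M"
      using cls[OF app[OF uv]] by (simp only: presented_monoid_mult_class)
  next
    show "\<one>\<^bsub>?M\<^esub> \<in> carrier ?M"
      unfolding one by (rule cls[OF nil])
  next
    fix a b c assume "a \<in> carrier ?M" "b \<in> carrier ?M" "c \<in> carrier ?M"
    then obtain u v w where "u \<in> lists X" "v \<in> lists X" "w \<in> lists X"
      and "a = word_cong X R `` {u}" "b = word_cong X R `` {v}" "c = word_cong X R `` {w}"
      using car by metis
    then show "a \<otimes>\<^bsub>?M\<^esub> b \<otimes>\<^bsub>?M\<^esub> c = a \<otimes>\<^bsub>?M\<^esub> (b \<otimes>\<^bsub>?M\<^esub> c)"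
      by (simp only: presented_monoid_mult_class app append_assoc)
  next
    fix a assume "a \<in> carrier ?M"
    then obtain u where u: "u \<in> lists X" and a: "a = word_cong X R `` {u}"
      using car by metis
    show "\<one>\<^bsub>?M\<^esub> \<otimes>\<^bsub>?M\<^esub> a = a"
      unfolding one a presented_monoid_mult_class[OF nil u] by simp
    show "a \<otimes>\<^bsub>?M\<^esub> \<one>\<^bsub>?M\<^esub> = a"
      unfolding one a presented_monoid_mult_class[OF u nil] by simp
  qed
qed


section \<open>Monoid algebras\<close>

text \<open>
  Elements of \<open>K[S]\<close> are the finitely supported functions from the carrier of \<open>S\<close> to \<open>K\<close>,
  represented by total functions that are zero outside the carrier. The product is convolution;
  the sum is restricted to the pairs where both factors are nonzero, which makes its index set
  finite.
\<close>

definition monoid_algebra ::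
  "('k, 'm) ring_scheme \<Rightarrow> ('s, 'p) monoid_scheme \<Rightarrow> ('k, 's \<Rightarrow> 'k) module" where
  "monoid_algebra K S =
    \<lparr>carrier = {f. (\<forall>s. f s \<in> carrier K) \<and> (\<forall>s. s \<notin> carrier S \<longrightarrow> f s = \<zero>\<^bsub>K\<^esub>) \<and>
                   finite {s. f s \<noteq> \<zero>\<^bsub>K\<^esub>}},
     mult = (\<lambda>f g s. \<Oplus>\<^bsub>K\<^esub>p\<in>{(u, v). u \<in> carrier S \<and> v \<in> carrier S \<and>
                     f u \<noteq> \<zero>\<^bsub>K\<^esub> \<and> g v \<noteq> \<zero>\<^bsub>K\<^esub> \<and> u \<otimes>\<^bsub>S\<^esub> v = s}.
                   f (fst p) \<otimes>\<^bsub>K\<^esub> g (snd p)),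
     one = (\<lambda>s. if s = \<one>\<^bsub>S\<^esub> then \<one>\<^bsub>K\<^esub> else \<zero>\<^bsub>K\<^esub>),
     zero = (\<lambda>s. \<zero>\<^bsub>K\<^esub>),
     add = (\<lambda>f g s. f s \<oplus>\<^bsub>K\<^esub> g s),
     smult = (\<lambda>c f s. c \<otimes>\<^bsub>K\<^esub> f s)\<rparr>"

text \<open>The free associative algebra \<open>K\<langle>y\<^sub>1,\<dots>,y\<^sub>r\<rangle>\<close>.\<close>

definition free_algebra :: "('k, 'm) ring_scheme \<Rightarrow> nat \<Rightarrow> ('k, nat list \<Rightarrow> 'k) module" where
  "free_algebra K r = monoid_algebra K (free_monoid {1..r})"


section \<open>Subalgebras and growth\<close>

text \<open>
  An associative unital \<open>K\<close>-algebra is given by a record of type \<^typ>\<open>('k, 'a) module\<close>, which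
  carries both the ring operations and the scalar multiplication. (The locale \<open>algebra\<close> of
  HOL-Algebra only covers commutative algebras.)
\<close>

definition subalg :: "('k, 'm) ring_scheme \<Rightarrow> ('k, 'a) module \<Rightarrow> 'a set \<Rightarrow> bool" where
  "subalg K A F \<longleftrightarrow> subspace K F A \<and> \<one>\<^bsub>A\<^esub> \<in> F \<and> (\<forall>a\<in>F. \<forall>b\<in>F. a \<otimes>\<^bsub>A\<^esub> b \<in> F)"

definition alg_generated :: "('k, 'm) ring_scheme \<Rightarrow> ('k, 'a) module \<Rightarrow> 'a set \<Rightarrow> 'a set" where
  "alg_generated K A X = \<Inter>{F. subalg K A F \<and> X \<subseteq> F}"

definition alg_iso ::
  "('k, 'm) ring_scheme \<Rightarrow> ('k, 'a) module \<Rightarrow> ('k, 'b) module \<Rightarrow> ('a \<Rightarrow> 'b) set" where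
  "alg_iso K A B = ring_iso A B \<inter> module_hom K A B"

text \<open>\<open>V\<^sup>m\<close>, the linear span of all products of \<open>m\<close> elements of \<open>V\<close>.\<close>

primrec subspace_power ::
  "('k, 'm) ring_scheme \<Rightarrow> ('k, 'a) module \<Rightarrow> 'a set \<Rightarrow> nat \<Rightarrow> 'a set" where
  "subspace_power K A V 0 = LinearCombinations.module.span K A {\<one>\<^bsub>A\<^esub>}"
| "subspace_power K A V (Suc m) =
    LinearCombinations.module.span K A {a \<otimes>\<^bsub>A\<^esub> v | a v. a \<in> subspace_power K A V m \<and> v \<in> V}"

definition generating_subspace ::
  "('k, 'm) ring_scheme \<Rightarrow> ('k, 'a) module \<Rightarrow> 'a set \<Rightarrow> bool" where
  "generating_subspace K A V \<longleftrightarrow>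
    subspace K V A \<and> vectorspace.fin_dim K (A\<lparr>carrier := V\<rparr>) \<and> \<one>\<^bsub>A\<^esub> \<in> V \<and>
    alg_generated K A V = carrier A"

text \<open>
  The growth condition does not depend on the choice of \<open>V\<close>; it is required for every \<open>V\<close>,
  together with the existence of some \<open>V\<close> (finite generation of the algebra).
\<close>

definition exponential_growth :: "('k, 'm) ring_scheme \<Rightarrow> ('k, 'a) module \<Rightarrow> bool" where
  "exponential_growth K A \<longleftrightarrow>
    (\<exists>V. generating_subspace K A V) \<and>
    (\<forall>V. generating_subspace K A V \<longrightarrow>
      limsup (\<lambda>m. ereal (root m (real
        (vectorspace.dim K (A\<lparr>carrier := subspace_power K A V m\<rparr>))))) > 1)"


section \<open>Free modules over free subalgebras\<close>

definition fg_free_subalgebra ::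
  "('k, 'm) ring_scheme \<Rightarrow> ('k, 'a) module \<Rightarrow> 'a set \<Rightarrow> bool" where
  "fg_free_subalgebra K A F \<longleftrightarrow>
    subalg K A F \<and> (\<exists>r. alg_iso K (free_algebra K r) (A\<lparr>carrier := F\<rparr>) \<noteq> {})"

text \<open>
  \<open>A\<close> as a right (left) module over its subring \<open>F\<close>, acting by right (left) multiplication, has
  a finite basis. The module locale of HOL-Algebra requires commutative scalars.
\<close>

definition fg_free_right_module :: "('a, 'b) ring_scheme \<Rightarrow> 'a set \<Rightarrow> bool" where
  "fg_free_right_module A F \<longleftrightarrow>
    (\<exists>B. finite B \<and> B \<subseteq> carrier A \<and>
      (\<forall>a\<in>carrier A. \<exists>c\<in>B \<rightarrow> F. a = (\<Oplus>\<^bsub>A\<^esub>b\<in>B. b \<otimes>\<^bsub>A\<^esub> c b)) \<and>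
      (\<forall>c\<in>B \<rightarrow> F. (\<Oplus>\<^bsub>A\<^esub>b\<in>B. b \<otimes>\<^bsub>A\<^esub> c b) = \<zero>\<^bsub>A\<^esub> \<longrightarrow> (\<forall>b\<in>B. c b = \<zero>\<^bsub>A\<^esub>)))"

definition fg_free_left_module :: "('a, 'b) ring_scheme \<Rightarrow> 'a set \<Rightarrow> bool" where
  "fg_free_left_module A F \<longleftrightarrow>
    (\<exists>B. finite B \<and> B \<subseteq> carrier A \<and>
      (\<forall>a\<in>carrier A. \<exists>c\<in>B \<rightarrow> F. a = (\<Oplus>\<^bsub>A\<^esub>b\<in>B. c b \<otimes>\<^bsub>A\<^esub> b)) \<and>
      (\<forall>c\<in>B \<rightarrow> F. (\<Oplus>\<^bsub>A\<^esub>b\<in>B. c b \<otimes>\<^bsub>A\<^esub> b) = \<zero>\<^bsub>A\<^esub> \<longrightarrow> (\<forall>b\<in>B. c b = \<zero>\<^bsub>A\<^esub>)))"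

end

theory Submission
  imports Defs
begin

text \<open>
  Write \<open>X = {1..n}\<close> and let \<open>A = K[S]\<close> be the algebra of the monoid \<open>S\<close>.

  Growth. If \<open>j\<close> is not in the \<open>H\<close>-orbit of \<open>i\<close>, colour a letter by whether it lies in the
  orbit of \<open>i\<close>. The defining relations preserve the colour of every letter, so different words in
  the two letters \<open>i, j\<close> are different elements of \<open>S\<close>: they form a free submonoid of rank two.
  For any generating subspace \<open>V\<close> both letters lie in some \<open>V\<^sup>k\<close>, because the union of the powers
  of \<open>V\<close> is a subalgebra. Hence \<open>V\<^sup>k\<^sup>m\<close> contains the \<open>2\<^sup>m\<close> words of length \<open>m\<close>, which are
  linearly independent, and the limit superior is at least the \<open>k\<close>-th root of \<open>2\<close>
  (\<open>exponential_growth_of_free_submonoid\<close>).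

  Freeness. Let \<open>H\<close> be semi-regular and abelian. Choose a representative in each orbit; every
  letter is \<open>\<chi>(r)\<close> for its representative \<open>r\<close> and a unique \<open>\<chi> \<in> H\<close>, its charge. Applying
  \<open>\<sigma>\<close> to \<open>l\<close> consecutive letters keeps all representatives and multiplies the charges of these
  letters by \<open>\<sigma>\<close>. Among \<open>l\<close> consecutive positions every residue class modulo \<open>l\<close> occurs exactly
  once, so the products of charges over the \<open>l\<close> residue classes of positions are all multiplied
  by the same \<open>\<sigma>\<close>. They are therefore an invariant up to a common factor in \<open>H\<close>
  (\<open>cong_total_charge\<close>). On the other hand, working from the last letter to the left, one can
  replace each letter that ends a block of length \<open>l\<close> by its representative. A word whose letters
  are representatives from the \<open>l\<close>-th one on is a normal form: one residue class has trivial
  charge, which fixes the common factor, and the others then show the charges of the first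
  \<open>l - 1\<close> letters (\<open>normal_unique\<close>, \<open>normal_exists\<close>).

  Splitting off the longest suffix of representatives writes each element of \<open>S\<close> uniquely as
  \<open>b w\<close>, where \<open>w\<close> is a word in the representatives and \<open>b\<close> is one of finitely many words of
  length less than \<open>l\<close> (\<open>right_decomposition\<close>). So the representatives generate a free submonoid,
  and \<open>S\<close> is a free right act over it with a finite basis; passing to the monoid algebra gives the
  free right module (\<open>free_act_fg_free_right_module\<close>). The relations are stable under reversal of
  words, which gives the left version over the same free algebra (\<open>left_decomposition\<close>).
\<close>

section \<open>Growth along a subsequence\<close>

text \<open>
  At the indices \<open>k m\<close> the root of \<open>2\<^sup>m\<close> is the constant \<open>root k 2 > 1\<close>, and infinitely many indices
  suffice for a limit superior.
\<close>

lemma limsup_root_exponential: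
  fixes d :: "nat \<Rightarrow> nat"
  assumes k: "k \<ge> 1" and d: "\<And>m. 2 ^ m \<le> d (k * m)"
  shows "limsup (\<lambda>m. ereal (root m (real (d m)))) > 1"
proof -
  have "ereal (root k 2) \<le> limsup (\<lambda>m. ereal (root m (real (d m))))"
  proof (rule ccontr)
    assume "\<not> ?thesis"
    then have "eventually (\<lambda>m. ereal (root m (real (d m))) < ereal (root k 2)) sequentially"
      by (intro Limsup_lessD) simp
    then obtain N where N: "\<And>m. m \<ge> N \<Longrightarrow> root m (real (d m)) < root k 2"
      by (auto simp: eventually_sequentially)
    define m where "m = Suc N"
    have m: "m > 0" "k * m \<ge> N"
      using mult_le_mono1[OF k, of "Suc N"] by (simp_all add: m_def)
    have "root k 2 = root (k * m) (2 ^ m)"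
      using m(1) by (simp add: real_root_mult_exp real_root_power_cancel)
    also have "\<dots> \<le> root (k * m) (real (d (k * m)))"
    proof (rule real_root_le_mono)
      have "real (2 ^ m) \<le> real (d (k * m))" using d by (simp only: of_nat_le_iff)
      then show "2 ^ m \<le> real (d (k * m))" by simp
    qed (use k m in simp)
    also have "\<dots> < root k 2" by (rule N[OF m(2)])
    finally show False by simp
  qed
  moreover have "1 < ereal (root k 2)" using k by simp
  ultimately show ?thesis by (rule less_le_trans[rotated])
qed

section \<open>The monoid algebra as an associative algebra\<close>

locale monoid_alg = K: field K + S: monoid S
  for K :: "('k, 'm) ring_scheme" (structure) and S :: "('s, 'p) monoid_scheme"
begin

abbreviation A :: "('k, 's \<Rightarrow> 'k) module" where
  "A \<equiv> monoid_algebra K S"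

definition single :: "'k \<Rightarrow> 's \<Rightarrow> 's \<Rightarrow> 'k" where
  "single c s = (\<lambda>t. if t = s then c else \<zero>)"

lemma A_operations:
  "\<zero>\<^bsub>A\<^esub> = (\<lambda>s. \<zero>)" "f \<oplus>\<^bsub>A\<^esub> g = (\<lambda>s. f s \<oplus> g s)" "c \<odot>\<^bsub>A\<^esub> f = (\<lambda>s. c \<otimes> f s)"
  by (simp_all add: monoid_algebra_def)

lemma one_A: "\<one>\<^bsub>A\<^esub> = single \<one> \<one>\<^bsub>S\<^esub>"
  by (simp add: monoid_algebra_def single_def)

lemma carrier_A:
  "f \<in> carrier A \<longleftrightarrow> (\<forall>s. f s \<in> carrier K) \<and> (\<forall>s. s \<notin> carrier S \<longrightarrow> f s = \<zero>) \<and> finite {s. f s \<noteq> \<zero>}"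
  by (simp add: monoid_algebra_def)

lemma A_coeff_closed: "f \<in> carrier A \<Longrightarrow> f s \<in> carrier K"
  and A_outside: "f \<in> carrier A \<Longrightarrow> s \<notin> carrier S \<Longrightarrow> f s = \<zero>"
  and A_finite: "f \<in> carrier A \<Longrightarrow> finite {s. f s \<noteq> \<zero>}"
  and A_supp: "f \<in> carrier A \<Longrightarrow> f s \<noteq> \<zero> \<Longrightarrow> s \<in> carrier S"
  by (auto simp: carrier_A)

lemma single_in_A [simp]: "c \<in> carrier K \<Longrightarrow> s \<in> carrier S \<Longrightarrow> single c s \<in> carrier A"
  by (auto simp: carrier_A single_def)

lemma mult_A:
  "(f \<otimes>\<^bsub>A\<^esub> g) s = (\<Oplus>p\<in>{(u, v). u \<in> carrier S \<and> v \<in> carrier S \<and> f u \<noteq> \<zero> \<and> g v \<noteq> \<zero> \<and>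
      u \<otimes>\<^bsub>S\<^esub> v = s}. f (fst p) \<otimes> g (snd p))"
  by (simp only: monoid_algebra_def monoid.select_convs)

text \<open>
  The index set of the defining sum depends on the point \<open>s\<close>. A fixed finite index set that
  covers the supports of both factors lets products be compared term by term.
\<close>

lemma mult_A_sum:
  assumes f: "f \<in> carrier A" and g: "g \<in> carrier A"
    and P: "finite P" "P \<subseteq> carrier S \<times> carrier S"
      "\<And>u v. f u \<noteq> \<zero> \<Longrightarrow> g v \<noteq> \<zero> \<Longrightarrow> (u, v) \<in> P"
  shows "(f \<otimes>\<^bsub>A\<^esub> g) s =
    (\<Oplus>p\<in>P. if fst p \<otimes>\<^bsub>S\<^esub> snd p = s then f (fst p) \<otimes> g (snd p) else \<zero>)"
  unfolding mult_A
  by (rule K.add.finprod_mono_neutral_cong_left)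
    (use P A_coeff_closed[OF f] A_coeff_closed[OF g] in auto)

lemma A_mult_closed: 
  assumes f: "f \<in> carrier A" and g: "g \<in> carrier A"
  shows "f \<otimes>\<^bsub>A\<^esub> g \<in> carrier A"
proof -
  let ?P = "{s. f s \<noteq> \<zero>} \<times> {s. g s \<noteq> \<zero>}"
  have P: "finite ?P" "?P \<subseteq> carrier S \<times> carrier S"
    using A_finite[OF f] A_finite[OF g] A_supp[OF f] A_supp[OF g] by auto
  have eq: "(f \<otimes>\<^bsub>A\<^esub> g) s =
    (\<Oplus>p\<in>?P. if fst p \<otimes>\<^bsub>S\<^esub> snd p = s then f (fst p) \<otimes> g (snd p) else \<zero>)" for s
    by (rule mult_A_sum[OF f g P]) auto
  have closed: "(f \<otimes>\<^bsub>A\<^esub> g) s \<in> carrier K" for s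
    unfolding eq using A_coeff_closed[OF f] A_coeff_closed[OF g] by (intro K.finsum_closed) auto
  have zero: "(f \<otimes>\<^bsub>A\<^esub> g) s = \<zero>" if "s \<notin> (\<lambda>p. fst p \<otimes>\<^bsub>S\<^esub> snd p) ` ?P" for s
    unfolding eq by (rule K.add.finprod_one_eqI) (use that in auto)
  have "{s. (f \<otimes>\<^bsub>A\<^esub> g) s \<noteq> \<zero>} \<subseteq> (\<lambda>p. fst p \<otimes>\<^bsub>S\<^esub> snd p) ` ?P"
    using zero by blast
  moreover have "finite ((\<lambda>p. fst p \<otimes>\<^bsub>S\<^esub> snd p) ` ?P)"
    using P(1) by blast
  ultimately have fin: "finite {s. (f \<otimes>\<^bsub>A\<^esub> g) s \<noteq> \<zero>}"
    by (rule finite_subset)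
  have "(f \<otimes>\<^bsub>A\<^esub> g) s = \<zero>" if "s \<notin> carrier S" for s
    by (rule zero) (use that P(2) in auto)
  with fin closed show ?thesis
    unfolding carrier_A by blast
qed

lemma single_mult_single:
  assumes "c \<in> carrier K" "d \<in> carrier K" "s \<in> carrier S" "t \<in> carrier S"
  shows "single c s \<otimes>\<^bsub>A\<^esub> single d t = single (c \<otimes> d) (s \<otimes>\<^bsub>S\<^esub> t)"
proof
  fix x
  have "(single c s \<otimes>\<^bsub>A\<^esub> single d t) x = (\<Oplus>p\<in>{(s, t)}. if fst p \<otimes>\<^bsub>S\<^esub> snd p = x
      then single c s (fst p) \<otimes> single d t (snd p) else \<zero>)"
    by (rule mult_A_sum[OF single_in_A single_in_A])
      (use assms in \<open>auto simp: single_def split: if_splits\<close>)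
  also have "\<dots> = single (c \<otimes> d) (s \<otimes>\<^bsub>S\<^esub> t) x"
    using assms by (simp add: single_def)
  finally show "(single c s \<otimes>\<^bsub>A\<^esub> single d t) x = single (c \<otimes> d) (s \<otimes>\<^bsub>S\<^esub> t) x" .
qed

lemma inj_single: "inj_on (single \<one>) U"
  by (rule inj_onI) (metis K.one_not_zero single_def)

lemma A_add_closed:
  assumes f: "f \<in> carrier A" and g: "g \<in> carrier A"
  shows "f \<oplus>\<^bsub>A\<^esub> g \<in> carrier A"
proof -
  have "finite {s. f s \<oplus> g s \<noteq> \<zero>}"
    by (rule finite_subset[OF _ finite_UnI[OF A_finite[OF f] A_finite[OF g]]]) auto
  then show ?thesis
    unfolding carrier_A A_operations using f g by (simp add: carrier_A)
qed

lemma A_smult_closed: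
  assumes c: "c \<in> carrier K" and f: "f \<in> carrier A"
  shows "c \<odot>\<^bsub>A\<^esub> f \<in> carrier A"
proof -
  have "finite {s. c \<otimes> f s \<noteq> \<zero>}"
    by (rule finite_subset[OF _ A_finite[OF f]]) (use c in auto)
  then show ?thesis
    unfolding carrier_A A_operations using c f by (simp add: carrier_A)
qed

lemma A_neg_closed:
  assumes f: "f \<in> carrier A"
  shows "(\<lambda>s. \<ominus> f s) \<in> carrier A"
proof -
  have "finite {s. \<ominus> f s \<noteq> \<zero>}"
    by (rule finite_subset[OF _ A_finite[OF f]]) auto
  then show ?thesis
    unfolding carrier_A using f by (simp add: carrier_A)
qed

lemma A_zero_closed: "\<zero>\<^bsub>A\<^esub> \<in> carrier A"
  by (simp add: carrier_A A_operations)

lemma A_vectorspace: "vectorspace K A"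
proof -
  have "module K A"
  proof (rule module_criteria)
    show "\<forall>v\<in>carrier A. \<exists>neg_v\<in>carrier A. v \<oplus>\<^bsub>A\<^esub> neg_v = \<zero>\<^bsub>A\<^esub>"
    proof
      fix v assume v: "v \<in> carrier A"
      then have "v \<oplus>\<^bsub>A\<^esub> (\<lambda>s. \<ominus> v s) = \<zero>\<^bsub>A\<^esub>"
        unfolding A_operations carrier_A by (simp add: K.r_neg)
      with A_neg_closed[OF v] show "\<exists>neg_v\<in>carrier A. v \<oplus>\<^bsub>A\<^esub> neg_v = \<zero>\<^bsub>A\<^esub>" by blast
    qed
    show "\<forall>v w. v \<in> carrier A \<and> w \<in> carrier A \<longrightarrow> v \<oplus>\<^bsub>A\<^esub> w \<in> carrier A"
      and "\<forall>c v. c \<in> carrier K \<and> v \<in> carrier A \<longrightarrow> c \<odot>\<^bsub>A\<^esub> v \<in> carrier A"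
      and "\<zero>\<^bsub>A\<^esub> \<in> carrier A"
      using A_add_closed A_smult_closed A_zero_closed by blast+
  qed (unfold A_operations, auto simp: carrier_A K.cring_axioms K.a_ac K.m_assoc K.l_distr K.r_distr)
  then show ?thesis
    by (simp add: vectorspace_def K.field_axioms)
qed

sublocale A: vectorspace K A
  by (rule A_vectorspace)

lemma A_l_distr:
  assumes f: "f \<in> carrier A" and g: "g \<in> carrier A" and h: "h \<in> carrier A"
  shows "(f \<oplus>\<^bsub>A\<^esub> g) \<otimes>\<^bsub>A\<^esub> h = f \<otimes>\<^bsub>A\<^esub> h \<oplus>\<^bsub>A\<^esub> g \<otimes>\<^bsub>A\<^esub> h"
proof
  fix s
  let ?P = "({s. f s \<noteq> \<zero>} \<union> {s. g s \<noteq> \<zero>}) \<times> {s. h s \<noteq> \<zero>}"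
  have P: "finite ?P" "?P \<subseteq> carrier S \<times> carrier S"
    using A_finite[OF f] A_finite[OF g] A_finite[OF h] A_supp[OF f] A_supp[OF g] A_supp[OF h]
    by auto
  note s = A_add_closed[OF f g] and cl = A_coeff_closed[OF f] A_coeff_closed[OF g] A_coeff_closed[OF h]
  have "((f \<oplus>\<^bsub>A\<^esub> g) \<otimes>\<^bsub>A\<^esub> h) s = (\<Oplus>p\<in>?P. if fst p \<otimes>\<^bsub>S\<^esub> snd p = s then (f \<oplus>\<^bsub>A\<^esub> g) (fst p) \<otimes> h (snd p) else \<zero>)"
    by (rule mult_A_sum[OF s h P]) (auto simp: A_operations)
  also have "\<dots> = (\<Oplus>p\<in>?P. (if fst p \<otimes>\<^bsub>S\<^esub> snd p = s then f (fst p) \<otimes> h (snd p) else \<zero>) \<oplus>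
      (if fst p \<otimes>\<^bsub>S\<^esub> snd p = s then g (fst p) \<otimes> h (snd p) else \<zero>))"
    by (rule K.finsum_cong') (use cl in \<open>auto simp: A_operations K.l_distr\<close>)
  also have "\<dots> = (\<Oplus>p\<in>?P. if fst p \<otimes>\<^bsub>S\<^esub> snd p = s then f (fst p) \<otimes> h (snd p) else \<zero>) \<oplus>
      (\<Oplus>p\<in>?P. if fst p \<otimes>\<^bsub>S\<^esub> snd p = s then g (fst p) \<otimes> h (snd p) else \<zero>)"
    by (rule K.finsum_addf) (use cl in auto)
  also have "(\<Oplus>p\<in>?P. if fst p \<otimes>\<^bsub>S\<^esub> snd p = s then f (fst p) \<otimes> h (snd p) else \<zero>) = (f \<otimes>\<^bsub>A\<^esub> h) s"
    by (rule mult_A_sum[OF f h P, symmetric]) auto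
  also have "(\<Oplus>p\<in>?P. if fst p \<otimes>\<^bsub>S\<^esub> snd p = s then g (fst p) \<otimes> h (snd p) else \<zero>) = (g \<otimes>\<^bsub>A\<^esub> h) s"
    by (rule mult_A_sum[OF g h P, symmetric]) auto
  finally show "((f \<oplus>\<^bsub>A\<^esub> g) \<otimes>\<^bsub>A\<^esub> h) s = (f \<otimes>\<^bsub>A\<^esub> h \<oplus>\<^bsub>A\<^esub> g \<otimes>\<^bsub>A\<^esub> h) s"
    by (simp only: A_operations)
qed

lemma A_r_distr:
  assumes f: "f \<in> carrier A" and g: "g \<in> carrier A" and h: "h \<in> carrier A"
  shows "h \<otimes>\<^bsub>A\<^esub> (f \<oplus>\<^bsub>A\<^esub> g) = h \<otimes>\<^bsub>A\<^esub> f \<oplus>\<^bsub>A\<^esub> h \<otimes>\<^bsub>A\<^esub> g"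
proof
  fix s
  let ?P = "{s. h s \<noteq> \<zero>} \<times> ({s. f s \<noteq> \<zero>} \<union> {s. g s \<noteq> \<zero>})"
  have P: "finite ?P" "?P \<subseteq> carrier S \<times> carrier S"
    using A_finite[OF f] A_finite[OF g] A_finite[OF h] A_supp[OF f] A_supp[OF g] A_supp[OF h]
    by auto
  note s = A_add_closed[OF f g] and cl = A_coeff_closed[OF f] A_coeff_closed[OF g] A_coeff_closed[OF h]
  have "(h \<otimes>\<^bsub>A\<^esub> (f \<oplus>\<^bsub>A\<^esub> g)) s = (\<Oplus>p\<in>?P. if fst p \<otimes>\<^bsub>S\<^esub> snd p = s then h (fst p) \<otimes> (f \<oplus>\<^bsub>A\<^esub> g) (snd p) else \<zero>)"
    by (rule mult_A_sum[OF h s P]) (auto simp: A_operations)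
  also have "\<dots> = (\<Oplus>p\<in>?P. (if fst p \<otimes>\<^bsub>S\<^esub> snd p = s then h (fst p) \<otimes> f (snd p) else \<zero>) \<oplus>
      (if fst p \<otimes>\<^bsub>S\<^esub> snd p = s then h (fst p) \<otimes> g (snd p) else \<zero>))"
    by (rule K.finsum_cong') (use cl in \<open>auto simp: A_operations K.r_distr\<close>)
  also have "\<dots> = (\<Oplus>p\<in>?P. if fst p \<otimes>\<^bsub>S\<^esub> snd p = s then h (fst p) \<otimes> f (snd p) else \<zero>) \<oplus>
      (\<Oplus>p\<in>?P. if fst p \<otimes>\<^bsub>S\<^esub> snd p = s then h (fst p) \<otimes> g (snd p) else \<zero>)"
    by (rule K.finsum_addf) (use cl in auto)
  also have "(\<Oplus>p\<in>?P. if fst p \<otimes>\<^bsub>S\<^esub> snd p = s then h (fst p) \<otimes> f (snd p) else \<zero>) = (h \<otimes>\<^bsub>A\<^esub> f) s"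
    by (rule mult_A_sum[OF h f P, symmetric]) auto
  also have "(\<Oplus>p\<in>?P. if fst p \<otimes>\<^bsub>S\<^esub> snd p = s then h (fst p) \<otimes> g (snd p) else \<zero>) = (h \<otimes>\<^bsub>A\<^esub> g) s"
    by (rule mult_A_sum[OF h g P, symmetric]) auto
  finally show "(h \<otimes>\<^bsub>A\<^esub> (f \<oplus>\<^bsub>A\<^esub> g)) s = (h \<otimes>\<^bsub>A\<^esub> f \<oplus>\<^bsub>A\<^esub> h \<otimes>\<^bsub>A\<^esub> g) s"
    by (simp only: A_operations)
qed

lemma A_zero_mult: "\<zero>\<^bsub>A\<^esub> \<otimes>\<^bsub>A\<^esub> f = \<zero>\<^bsub>A\<^esub>" "f \<otimes>\<^bsub>A\<^esub> \<zero>\<^bsub>A\<^esub> = \<zero>\<^bsub>A\<^esub>"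
  by (rule ext, simp only: mult_A A_operations, simp)+

text \<open>
  Elements are finite sums of one-point functions, so identities that are additive in each
  argument need to be checked only on one-point functions.
\<close>

lemma A_induct [consumes 1, case_names zero add]:
  assumes f: "f \<in> carrier A"
    and zero: "P \<zero>\<^bsub>A\<^esub>"
    and add: "\<And>g c s. g \<in> carrier A \<Longrightarrow> P g \<Longrightarrow> c \<in> carrier K \<Longrightarrow> s \<in> carrier S \<Longrightarrow>
      P (g \<oplus>\<^bsub>A\<^esub> single c s)"
  shows "P f"
proof -
  have "P f" if "finite X" "f \<in> carrier A" "{s. f s \<noteq> \<zero>} \<subseteq> X" for X f
    using that
  proof (induction X arbitrary: f)
    case empty
    then have "f = \<zero>\<^bsub>A\<^esub>" unfolding A_operations by auto
    then show ?case using zero by simp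
  next
    case (insert x X)
    show ?case
    proof (cases "f x = \<zero>")
      case True
      then have "{s. f s \<noteq> \<zero>} \<subseteq> X" using insert.prems(2) by auto
      then show ?thesis using insert.IH insert.prems(1) by blast
    next
      case False
      define g where "g = (\<lambda>s. if s = x then \<zero> else f s)"
      have x: "x \<in> carrier S" using A_supp[OF insert.prems(1) False] .
      have g: "g \<in> carrier A"
        unfolding carrier_A
      proof (intro conjI allI impI)
        show "finite {s. g s \<noteq> \<zero>}"
          by (rule finite_subset[OF _ A_finite[OF insert.prems(1)]]) (auto simp: g_def)
      qed (use insert.prems(1)[unfolded carrier_A] in \<open>simp_all add: g_def\<close>)
      have "P g"
        by (rule insert.IH[OF g]) (use insert.prems in \<open>auto simp: g_def\<close>)
      moreover have "f = g \<oplus>\<^bsub>A\<^esub> single (f x) x"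
        unfolding A_operations g_def single_def using A_coeff_closed[OF insert.prems(1)] by (intro ext) simp
      ultimately show ?thesis
        using add[OF g _ A_coeff_closed[OF insert.prems(1)] x] by metis
    qed
  qed
  then show ?thesis using f A_finite by blast
qed

lemma A_assoc:
  assumes f: "f \<in> carrier A" and g: "g \<in> carrier A" and h: "h \<in> carrier A"
  shows "(f \<otimes>\<^bsub>A\<^esub> g) \<otimes>\<^bsub>A\<^esub> h = f \<otimes>\<^bsub>A\<^esub> (g \<otimes>\<^bsub>A\<^esub> h)"
proof -
  have 1: "(single a s \<otimes>\<^bsub>A\<^esub> single b t) \<otimes>\<^bsub>A\<^esub> h = single a s \<otimes>\<^bsub>A\<^esub> (single b t \<otimes>\<^bsub>A\<^esub> h)"
    if "a \<in> carrier K" "b \<in> carrier K" "s \<in> carrier S" "t \<in> carrier S" for a b s t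
    using h
    by (induction h rule: A_induct)
      (use that in \<open>simp_all add: A_zero_mult A_r_distr A_mult_closed single_mult_single
         K.m_assoc S.m_assoc\<close>)
  have 2: "(single a s \<otimes>\<^bsub>A\<^esub> g) \<otimes>\<^bsub>A\<^esub> h = single a s \<otimes>\<^bsub>A\<^esub> (g \<otimes>\<^bsub>A\<^esub> h)"
    if "a \<in> carrier K" "s \<in> carrier S" for a s
    using g
    by (induction g rule: A_induct)
      (use that h in \<open>simp_all add: A_zero_mult A_r_distr A_l_distr A_mult_closed 1\<close>)
  show ?thesis
    using f
    by (induction f rule: A_induct)
      (use g h in \<open>simp_all add: A_zero_mult A_l_distr A_mult_closed 2\<close>)
qed

lemma A_one_mult:
  assumes "f \<in> carrier A"
  shows "\<one>\<^bsub>A\<^esub> \<otimes>\<^bsub>A\<^esub> f = f" "f \<otimes>\<^bsub>A\<^esub> \<one>\<^bsub>A\<^esub> = f"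
  using assms
  by (induction f rule: A_induct)
    (simp_all add: A_zero_mult A_l_distr A_r_distr one_A single_mult_single)

lemma smult_single: "c \<odot>\<^bsub>A\<^esub> single d s = single (c \<otimes> d) s" if "c \<in> carrier K" "d \<in> carrier K"
  using that by (auto simp: A_operations single_def)

text \<open>
  Scalars embed centrally as multiples of the identity; compatibility of scalar multiplication
  with the product becomes an instance of associativity.
\<close>

lemma A_smult_eq_mult:
  assumes c: "c \<in> carrier K" and f: "f \<in> carrier A"
  shows "single c \<one>\<^bsub>S\<^esub> \<otimes>\<^bsub>A\<^esub> f = c \<odot>\<^bsub>A\<^esub> f"
    and "f \<otimes>\<^bsub>A\<^esub> single c \<one>\<^bsub>S\<^esub> = c \<odot>\<^bsub>A\<^esub> f"
  using f
proof (induction f rule: A_induct)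
  case zero
  show "single c \<one>\<^bsub>S\<^esub> \<otimes>\<^bsub>A\<^esub> \<zero>\<^bsub>A\<^esub> = c \<odot>\<^bsub>A\<^esub> \<zero>\<^bsub>A\<^esub>" "\<zero>\<^bsub>A\<^esub> \<otimes>\<^bsub>A\<^esub> single c \<one>\<^bsub>S\<^esub> = c \<odot>\<^bsub>A\<^esub> \<zero>\<^bsub>A\<^esub>"
    using c by (simp_all add: A_zero_mult)
next
  case (add g d s)
  note r = A.smult_r_distr[OF c add.hyps(1) single_in_A[OF add.hyps(2,3)]]
  show "single c \<one>\<^bsub>S\<^esub> \<otimes>\<^bsub>A\<^esub> (g \<oplus>\<^bsub>A\<^esub> single d s) = c \<odot>\<^bsub>A\<^esub> (g \<oplus>\<^bsub>A\<^esub> single d s)"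
    unfolding r using c add by (simp add: A_r_distr smult_single single_mult_single)
  show "(g \<oplus>\<^bsub>A\<^esub> single d s) \<otimes>\<^bsub>A\<^esub> single c \<one>\<^bsub>S\<^esub> = c \<odot>\<^bsub>A\<^esub> (g \<oplus>\<^bsub>A\<^esub> single d s)"
    unfolding r using c add by (simp add: A_l_distr smult_single single_mult_single K.m_comm[of d c])
qed

lemma A_smult_mult:
  assumes c: "c \<in> carrier K" and f: "f \<in> carrier A" and g: "g \<in> carrier A"
  shows "(c \<odot>\<^bsub>A\<^esub> f) \<otimes>\<^bsub>A\<^esub> g = c \<odot>\<^bsub>A\<^esub> (f \<otimes>\<^bsub>A\<^esub> g)"
    and "f \<otimes>\<^bsub>A\<^esub> (c \<odot>\<^bsub>A\<^esub> g) = c \<odot>\<^bsub>A\<^esub> (f \<otimes>\<^bsub>A\<^esub> g)"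
  using A_assoc[OF single_in_A[OF c S.one_closed] f g] A_assoc[OF f g single_in_A[OF c S.one_closed]]
    assms by (simp_all add: A_smult_eq_mult A_mult_closed)

lemma finsum_A_apply:
  assumes "finite I" "\<And>i. i \<in> I \<Longrightarrow> g i \<in> carrier A"
  shows "(\<Oplus>\<^bsub>A\<^esub>i\<in>I. g i) s = (\<Oplus>i\<in>I. g i s)"
  using assms
proof (induction I)
  case empty
  show ?case by (simp add: A_operations)
next
  case (insert i I)
  then have "(\<Oplus>\<^bsub>A\<^esub>i\<in>insert i I. g i) = g i \<oplus>\<^bsub>A\<^esub> (\<Oplus>\<^bsub>A\<^esub>i\<in>I. g i)"
    by (intro A.finsum_insert) auto
  moreover have "(\<Oplus>i\<in>insert i I. g i s) = g i s \<oplus> (\<Oplus>i\<in>I. g i s)"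
    by (intro K.finsum_insert) (use insert in \<open>auto intro: A_coeff_closed\<close>)
  ultimately show ?case
    using insert.IH insert.prems unfolding A_operations by simp
qed

section \<open>Submonoids and free acts\<close>

definition supported :: "'s set \<Rightarrow> ('s \<Rightarrow> 'k) set" where
  "supported W = {f \<in> carrier A. \<forall>s. f s \<noteq> \<zero> \<longrightarrow> s \<in> W}"

lemma subalg_supported:
  assumes W: "W \<subseteq> carrier S" "\<one>\<^bsub>S\<^esub> \<in> W" "\<And>u v. u \<in> W \<Longrightarrow> v \<in> W \<Longrightarrow> u \<otimes>\<^bsub>S\<^esub> v \<in> W"
  shows "subalg K A (supported W)"
  unfolding subalg_def
proof (intro conjI ballI)
  have "submodule K (supported W) A"
  proof (rule submodule.intro)
    show "module K A" by (rule A.module_axioms)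
    show "supported W \<subseteq> carrier A" by (auto simp: supported_def)
    show "\<zero>\<^bsub>A\<^esub> \<in> supported W"
      using A_zero_closed by (simp add: supported_def A_operations)
    show "v \<oplus>\<^bsub>A\<^esub> w \<in> supported W" if "v \<in> supported W" "w \<in> supported W" for v w
    proof -
      have "s \<in> W" if "(v \<oplus>\<^bsub>A\<^esub> w) s \<noteq> \<zero>" for s
      proof (rule ccontr)
        assume "s \<notin> W"
        then have "v s = \<zero>" "w s = \<zero>"
          using \<open>v \<in> supported W\<close> \<open>w \<in> supported W\<close> by (auto simp: supported_def)
        then show False using that by (simp add: A_operations)
      qed
      then show ?thesis using that A_add_closed by (simp add: supported_def)
    qed
    show "c \<odot>\<^bsub>A\<^esub> v \<in> supported W" if "c \<in> carrier K" "v \<in> supported W" for c v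
    proof -
      have "s \<in> W" if "(c \<odot>\<^bsub>A\<^esub> v) s \<noteq> \<zero>" for s
      proof (rule ccontr)
        assume "s \<notin> W"
        then have "v s = \<zero>" using \<open>v \<in> supported W\<close> by (auto simp: supported_def)
        then show False using that \<open>c \<in> carrier K\<close> by (simp add: A_operations)
      qed
      then show ?thesis using that A_smult_closed by (simp add: supported_def)
    qed
  qed
  then show "subspace K (supported W) A"
    by (rule subspace.intro[OF A.vectorspace_axioms])
  have "s \<in> W" if "single \<one> \<one>\<^bsub>S\<^esub> s \<noteq> \<zero>" for s
    using that W(2) by (auto simp: single_def split: if_splits)
  then show "\<one>\<^bsub>A\<^esub> \<in> supported W"
    unfolding one_A supported_def using single_in_A by simp
next
  fix f g assume f: "f \<in> supported W" and g: "g \<in> supported W"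
  have "s \<in> W" if "(f \<otimes>\<^bsub>A\<^esub> g) s \<noteq> \<zero>" for s
  proof (rule ccontr)
    assume s: "s \<notin> W"
    have "{(u, v). u \<in> carrier S \<and> v \<in> carrier S \<and> f u \<noteq> \<zero> \<and> g v \<noteq> \<zero> \<and> u \<otimes>\<^bsub>S\<^esub> v = s} = {}"
      using f g s W(3) unfolding supported_def by blast
    then have "(f \<otimes>\<^bsub>A\<^esub> g) s = \<zero>" unfolding mult_A by (simp only: K.finsum_empty)
    then show False using that by simp
  qed
  then show "f \<otimes>\<^bsub>A\<^esub> g \<in> supported W"
    using f g A_mult_closed by (simp add: supported_def)
qed

text \<open>
  The isomorphism extends a function on \<open>T\<close> by zero along the injection \<open>\<phi>\<close>. Injectivity turns
  the convolution sum over \<open>T\<close> into the one over the image by reindexing.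
\<close>

lemma monoid_embedding_alg_iso:
  fixes T :: "('t, 'q) monoid_scheme"
  assumes T: "monoid T" and \<phi>: "\<phi> \<in> hom T S" "\<phi> \<one>\<^bsub>T\<^esub> = \<one>\<^bsub>S\<^esub>" and inj: "inj_on \<phi> (carrier T)"
  shows "alg_iso K (monoid_algebra K T) (A\<lparr>carrier := supported (\<phi> ` carrier T)\<rparr>) \<noteq> {}"
proof -
  interpret T: monoid_alg K T
    by (intro monoid_alg.intro K.field_axioms T)
  let ?W = "\<phi> ` carrier T" and ?B = "A\<lparr>carrier := supported (\<phi> ` carrier T)\<rparr>"
  define h where "h f s = (if s \<in> ?W then f (inv_into (carrier T) \<phi> s) else \<zero>)"
    for f :: "'t \<Rightarrow> 'k" and s
  have \<phi>_closed: "\<phi> t \<in> carrier S" if "t \<in> carrier T" for t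
    using \<phi>(1) that by (auto simp: hom_def)
  have \<phi>_mult: "\<phi> (t \<otimes>\<^bsub>T\<^esub> u) = \<phi> t \<otimes>\<^bsub>S\<^esub> \<phi> u" if "t \<in> carrier T" "u \<in> carrier T" for t u
    using \<phi>(1) that by (auto simp: hom_def)
  have h_\<phi>: "h f (\<phi> t) = f t" if "t \<in> carrier T" for f t
    using that inj by (simp add: h_def)
  have h_out: "h f s = \<zero>" if "s \<notin> ?W" for f s
    using that by (simp add: h_def)
  have eq_on_image: "f = g" if "\<And>t. t \<in> carrier T \<Longrightarrow> f (\<phi> t) = g (\<phi> t)"
    "\<And>s. s \<notin> ?W \<Longrightarrow> f s = \<zero>" "\<And>s. s \<notin> ?W \<Longrightarrow> g s = \<zero>" for f g :: "'s \<Rightarrow> 'k"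
  proof
    fix s show "f s = g s"
      using that by (cases "s \<in> ?W") auto
  qed
  have h_supp: "{s. h f s \<noteq> \<zero>} = \<phi> ` {t. f t \<noteq> \<zero>}" if f: "f \<in> carrier T.A" for f
  proof (intro equalityI subsetI)
    fix s assume "s \<in> {s. h f s \<noteq> \<zero>}"
    then obtain t where "t \<in> carrier T" "s = \<phi> t" "f t \<noteq> \<zero>"
      using h_out h_\<phi> by (metis (mono_tags, lifting) imageE mem_Collect_eq)
    then show "s \<in> \<phi> ` {t. f t \<noteq> \<zero>}" by blast
  next
    fix s assume "s \<in> \<phi> ` {t. f t \<noteq> \<zero>}"
    then obtain t where "s = \<phi> t" "f t \<noteq> \<zero>" by blast
    then show "s \<in> {s. h f s \<noteq> \<zero>}" using h_\<phi> T.A_supp[OF f] by simp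
  qed
  have h_A: "h f \<in> carrier A" if f: "f \<in> carrier T.A" for f
    unfolding carrier_A
  proof (intro conjI allI impI)
    show "finite {s. h f s \<noteq> \<zero>}"
      unfolding h_supp[OF f] using T.A_finite[OF f] by (rule finite_imageI)
    show "h f s \<in> carrier K" for s
      using T.A_coeff_closed[OF f] by (simp add: h_def)
    show "h f s = \<zero>" if "s \<notin> carrier S" for s
      by (rule h_out) (use that \<phi>_closed in blast)
  qed
  have h_B: "h f \<in> supported ?W" if "f \<in> carrier T.A" for f
    unfolding supported_def using h_A[OF that] h_out by blast
  have h_mult: "h (f \<otimes>\<^bsub>T.A\<^esub> g) = h f \<otimes>\<^bsub>A\<^esub> h g" if f: "f \<in> carrier T.A" and g: "g \<in> carrier T.A" for f g
  proof
    fix s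
    let ?Q = "{t. f t \<noteq> \<zero>} \<times> {t. g t \<noteq> \<zero>}"
    have Q: "finite ?Q" "?Q \<subseteq> carrier T \<times> carrier T"
      using T.A_finite[OF f] T.A_finite[OF g] T.A_supp[OF f] T.A_supp[OF g] by auto
    have inj_Q: "inj_on (map_prod \<phi> \<phi>) ?Q"
      by (rule inj_on_subset[OF map_prod_inj_on[OF inj inj] Q(2)])
    let ?r = "\<lambda>p. if fst p \<otimes>\<^bsub>S\<^esub> snd p = s then h f (fst p) \<otimes> h g (snd p) else \<zero>"
    have "(h f \<otimes>\<^bsub>A\<^esub> h g) s = (\<Oplus>p\<in>map_prod \<phi> \<phi> ` ?Q. ?r p)"
    proof (rule mult_A_sum[OF h_A[OF f] h_A[OF g]])
      show "finite (map_prod \<phi> \<phi> ` ?Q)" using Q(1) by (rule finite_imageI)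
      show "map_prod \<phi> \<phi> ` ?Q \<subseteq> carrier S \<times> carrier S"
        using Q(2) \<phi>_closed by auto
      fix u v assume "h f u \<noteq> \<zero>" "h g v \<noteq> \<zero>"
      then have "u \<in> \<phi> ` {t. f t \<noteq> \<zero>}" "v \<in> \<phi> ` {t. g t \<noteq> \<zero>}"
        unfolding h_supp[OF f, symmetric] h_supp[OF g, symmetric] by simp_all
      then show "(u, v) \<in> map_prod \<phi> \<phi> ` ?Q" by blast
    qed
    also have "\<dots> = (\<Oplus>p\<in>?Q. ?r (map_prod \<phi> \<phi> p))"
      by (rule K.finsum_reindex[OF _ inj_Q])
        (use A_coeff_closed[OF h_A[OF f]] A_coeff_closed[OF h_A[OF g]] in auto)
    also have "\<dots> = (\<Oplus>p\<in>?Q. if \<phi> (fst p \<otimes>\<^bsub>T\<^esub> snd p) = s then f (fst p) \<otimes> g (snd p) else \<zero>)"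
    proof (rule K.finsum_cong')
      fix p assume "p \<in> ?Q"
      then have "fst p \<in> carrier T" "snd p \<in> carrier T" using Q(2) by auto
      then show "?r (map_prod \<phi> \<phi> p) =
          (if \<phi> (fst p \<otimes>\<^bsub>T\<^esub> snd p) = s then f (fst p) \<otimes> g (snd p) else \<zero>)"
        by (simp add: \<phi>_mult h_\<phi>)
    qed (use T.A_coeff_closed[OF f] T.A_coeff_closed[OF g] in auto)
    also have "\<dots> = h (f \<otimes>\<^bsub>T.A\<^esub> g) s"
    proof (cases "s \<in> ?W")
      case True
      then obtain t where t: "t \<in> carrier T" "s = \<phi> t" by blast
      have "(\<Oplus>p\<in>?Q. if \<phi> (fst p \<otimes>\<^bsub>T\<^esub> snd p) = s then f (fst p) \<otimes> g (snd p) else \<zero>) =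
          (\<Oplus>p\<in>?Q. if fst p \<otimes>\<^bsub>T\<^esub> snd p = t then f (fst p) \<otimes> g (snd p) else \<zero>)"
      proof (rule K.finsum_cong')
        fix p assume "p \<in> ?Q"
        then have "fst p \<otimes>\<^bsub>T\<^esub> snd p \<in> carrier T" using Q(2) by auto
        then have "\<phi> (fst p \<otimes>\<^bsub>T\<^esub> snd p) = s \<longleftrightarrow> fst p \<otimes>\<^bsub>T\<^esub> snd p = t"
          using t inj_onD[OF inj] by blast
        then show "(if \<phi> (fst p \<otimes>\<^bsub>T\<^esub> snd p) = s then f (fst p) \<otimes> g (snd p) else \<zero>) =
            (if fst p \<otimes>\<^bsub>T\<^esub> snd p = t then f (fst p) \<otimes> g (snd p) else \<zero>)" by simp
      qed (use T.A_coeff_closed[OF f] T.A_coeff_closed[OF g] in auto)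
      also have "\<dots> = (f \<otimes>\<^bsub>T.A\<^esub> g) t"
        by (rule T.mult_A_sum[OF f g Q, symmetric]) auto
      finally show ?thesis using t h_\<phi> by simp
    next
      case False
      have "(\<Oplus>p\<in>?Q. if \<phi> (fst p \<otimes>\<^bsub>T\<^esub> snd p) = s then f (fst p) \<otimes> g (snd p) else \<zero>) = \<zero>"
      proof (rule K.add.finprod_one_eqI)
        fix p assume "p \<in> ?Q"
        then have "fst p \<otimes>\<^bsub>T\<^esub> snd p \<in> carrier T" using Q(2) by auto
        then show "(if \<phi> (fst p \<otimes>\<^bsub>T\<^esub> snd p) = s then f (fst p) \<otimes> g (snd p) else \<zero>) = \<zero>"
          using False by auto
      qed
      then show ?thesis using h_out[OF False] by simp
    qed
    finally show "h (f \<otimes>\<^bsub>T.A\<^esub> g) s = (h f \<otimes>\<^bsub>A\<^esub> h g) s" by simp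
  qed
  have h_add: "h (f \<oplus>\<^bsub>T.A\<^esub> g) = h f \<oplus>\<^bsub>A\<^esub> h g" for f g
    by (rule ext) (simp add: A_operations T.A_operations h_def)
  have h_smult: "h (c \<odot>\<^bsub>T.A\<^esub> f) = c \<odot>\<^bsub>A\<^esub> h f" if "c \<in> carrier K" for c f
    by (rule ext) (simp add: A_operations T.A_operations h_def that)
  have h_one: "h \<one>\<^bsub>T.A\<^esub> = \<one>\<^bsub>A\<^esub>"
  proof (rule eq_on_image)
    fix t assume t: "t \<in> carrier T"
    have "\<phi> t = \<one>\<^bsub>S\<^esub> \<longleftrightarrow> t = \<one>\<^bsub>T\<^esub>"
      using inj_onD[OF inj _ t, of "\<one>\<^bsub>T\<^esub>"] \<phi>(2) T.S.one_closed by auto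
    then show "h \<one>\<^bsub>T.A\<^esub> (\<phi> t) = \<one>\<^bsub>A\<^esub> (\<phi> t)"
      unfolding h_\<phi>[OF t] one_A T.one_A by (simp add: single_def T.single_def)
  next
    fix s assume "s \<notin> ?W"
    then show "h \<one>\<^bsub>T.A\<^esub> s = \<zero>" by (rule h_out)
    have "s \<noteq> \<one>\<^bsub>S\<^esub>" using \<open>s \<notin> ?W\<close> \<phi>(2) T.S.one_closed by (metis image_eqI)
    then show "\<one>\<^bsub>A\<^esub> s = \<zero>" unfolding one_A by (simp add: single_def)
  qed
  have "bij_betw h (carrier T.A) (supported ?W)"
  proof (rule bij_betw_imageI)
    show "inj_on h (carrier T.A)"
    proof (rule inj_onI, rule ext)
      fix f g t assume f: "f \<in> carrier T.A" and g: "g \<in> carrier T.A" and eq: "h f = h g"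
      show "f t = g t"
      proof (cases "t \<in> carrier T")
        case True
        then show ?thesis using h_\<phi>[OF True] eq by metis
      next
        case False
        then show ?thesis using T.A_outside[OF f] T.A_outside[OF g] by metis
      qed
    qed
    show "h ` carrier T.A = supported ?W"
    proof (intro equalityI subsetI)
      fix f assume "f \<in> supported ?W"
      then have f: "f \<in> carrier A" and supp: "\<And>s. s \<notin> ?W \<Longrightarrow> f s = \<zero>"
        by (auto simp: supported_def)
      define g where "g t = (if t \<in> carrier T then f (\<phi> t) else \<zero>)" for t
      have "g \<in> carrier T.A"
        unfolding T.carrier_A
      proof (intro conjI allI impI)
        show "finite {t. g t \<noteq> \<zero>}"
        proof (rule finite_subset)
          show "{t. g t \<noteq> \<zero>} \<subseteq> \<phi> -` {s. f s \<noteq> \<zero>} \<inter> carrier T" by (auto simp: g_def)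
          show "finite (\<phi> -` {s. f s \<noteq> \<zero>} \<inter> carrier T)"
            by (rule finite_vimage_IntI[OF A_finite[OF f] inj])
        qed
      qed (use A_coeff_closed[OF f] in \<open>simp_all add: g_def\<close>)
      moreover have "h g = f"
        by (rule eq_on_image) (simp_all add: h_\<phi> h_out supp g_def)
      ultimately show "f \<in> h ` carrier T.A" by blast
    qed (use h_B in blast)
  qed
  then have "h \<in> alg_iso K T.A ?B"
    using h_B h_mult h_add h_one h_smult
    by (simp add: alg_iso_def ring_iso_def ring_hom_def module_hom_def Pi_def)
  then show ?thesis by blast
qed

text \<open>
  The common core of the right and the left version. The parametrisation \<open>p\<close> arranges \<open>S\<close> into
  finitely many copies of \<open>T\<close>, one for each basis element \<open>e i\<close>, and \<open>op\<close> is multiplication by a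
  coefficient on the appropriate side. The hypothesis \<open>coord\<close> says that \<open>op (e i) c\<close> is a copy of
  \<open>c\<close> living on the \<open>i\<close>-th copy only, so the coefficients of an element are its restrictions to
  the copies.
\<close>

lemma fg_free_by_coordinates:
  fixes T :: "('t, 'q) monoid_scheme" and op :: "('s \<Rightarrow> 'k) \<Rightarrow> ('s \<Rightarrow> 'k) \<Rightarrow> ('s \<Rightarrow> 'k)"
  assumes I: "finite I" and inj: "inj_on \<phi> (carrier T)" and \<phi>: "\<phi> ` carrier T \<subseteq> carrier S"
    and bij: "bij_betw (\<lambda>(i, t). p i t) (I \<times> carrier T) (carrier S)"
    and e: "inj_on e I" "e ` I \<subseteq> carrier A"
    and op: "\<And>i c. i \<in> I \<Longrightarrow> c \<in> supported (\<phi> ` carrier T) \<Longrightarrow> op (e i) c \<in> carrier A"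
    and coord: "\<And>i j c t. i \<in> I \<Longrightarrow> j \<in> I \<Longrightarrow> c \<in> supported (\<phi> ` carrier T) \<Longrightarrow> t \<in> carrier T \<Longrightarrow>
      op (e i) c (p j t) = (if i = j then c (\<phi> t) else \<zero>)"
  shows "\<exists>B. finite B \<and> B \<subseteq> carrier A \<and>
    (\<forall>a\<in>carrier A. \<exists>c\<in>B \<rightarrow> supported (\<phi> ` carrier T). a = (\<Oplus>\<^bsub>A\<^esub>b\<in>B. op b (c b))) \<and>
    (\<forall>c\<in>B \<rightarrow> supported (\<phi> ` carrier T). (\<Oplus>\<^bsub>A\<^esub>b\<in>B. op b (c b)) = \<zero>\<^bsub>A\<^esub> \<longrightarrow> (\<forall>b\<in>B. c b = \<zero>\<^bsub>A\<^esub>))"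
proof (intro exI[of _ "e ` I"] conjI ballI impI)
  let ?F = "supported (\<phi> ` carrier T)"
  show "finite (e ` I)" using I by (rule finite_imageI)
  show "e ` I \<subseteq> carrier A" by (rule e(2))
  have op_A: "op b (c b) \<in> carrier A" if "c \<in> e ` I \<rightarrow> ?F" "b \<in> e ` I" for b c
    using that op by auto
  have eval: "(\<Oplus>\<^bsub>A\<^esub>b\<in>e ` I. op b (c b)) (p j t) = c (e j) (\<phi> t)"
    if c: "c \<in> e ` I \<rightarrow> ?F" and j: "j \<in> I" and t: "t \<in> carrier T" for c j t
  proof -
    have cl: "c (e i) \<in> ?F" if "i \<in> I" for i using c that by auto
    then have cK: "c (e i) s \<in> carrier K" if "i \<in> I" for i s
      using that A_coeff_closed unfolding supported_def by blast
    have "(\<Oplus>\<^bsub>A\<^esub>b\<in>e ` I. op b (c b)) (p j t) = (\<Oplus>b\<in>e ` I. op b (c b) (p j t))"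
      by (rule finsum_A_apply) (use I op_A[OF c] in auto)
    also have "\<dots> = (\<Oplus>i\<in>I. op (e i) (c (e i)) (p j t))"
      by (rule K.finsum_reindex[OF _ e(1)]) (use op_A[OF c] A_coeff_closed in blast)
    also have "\<dots> = (\<Oplus>i\<in>I. if j = i then c (e i) (\<phi> t) else \<zero>)"
      by (rule K.finsum_cong') (use coord[OF _ j cl t] cK in auto)
    also have "\<dots> = c (e j) (\<phi> t)"
      by (rule K.finsum_singleton[OF j I]) (use cK in auto)
    finally show ?thesis .
  qed
  have sum_A: "(\<Oplus>\<^bsub>A\<^esub>b\<in>e ` I. op b (c b)) \<in> carrier A" if "c \<in> e ` I \<rightarrow> ?F" for c
    by (rule A.finsum_closed) (use op_A[OF that] in blast)
  have p_inj: "inj_on (p i) (carrier T)" if "i \<in> I" for i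
  proof (rule inj_onI)
    fix t u assume "t \<in> carrier T" "u \<in> carrier T" "p i t = p i u"
    then show "t = u"
      using inj_onD[OF bij_betw_imp_inj_on[OF bij], of "(i, t)" "(i, u)"] that by simp
  qed
  {
    fix a assume a: "a \<in> carrier A"
    \<comment> \<open>The coefficient at \<open>b\<close> is the restriction of \<open>a\<close> to the copy of \<open>T\<close> that belongs to \<open>b\<close>.\<close>
    define c where "c b = (\<lambda>s. if s \<in> \<phi> ` carrier T
      then a (p (inv_into I e b) (inv_into (carrier T) \<phi> s)) else \<zero>)" for b
    have c_\<phi>: "c (e i) (\<phi> t) = a (p i t)" if "i \<in> I" "t \<in> carrier T" for i t
      using that e(1) inj by (simp add: c_def)
    have c: "c \<in> e ` I \<rightarrow> ?F"
    proof (rule Pi_I, elim imageE)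
      fix b i assume b: "b = e i" and i: "i \<in> I"
      have out: "c b s = \<zero>" if "s \<notin> \<phi> ` carrier T" for s using that by (simp add: c_def)
      have "finite (p i -` {s. a s \<noteq> \<zero>} \<inter> carrier T)"
        by (rule finite_vimage_IntI[OF A_finite[OF a] p_inj[OF i]])
      moreover have "{s. c b s \<noteq> \<zero>} \<subseteq> \<phi> ` (p i -` {s. a s \<noteq> \<zero>} \<inter> carrier T)"
      proof
        fix s assume s: "s \<in> {s. c b s \<noteq> \<zero>}"
        then obtain t where "t \<in> carrier T" "s = \<phi> t" using out by blast
        then show "s \<in> \<phi> ` (p i -` {s. a s \<noteq> \<zero>} \<inter> carrier T)"
          using s c_\<phi>[OF i] b by auto
      qed
      ultimately have "finite {s. c b s \<noteq> \<zero>}"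
        by (meson finite_imageI finite_subset)
      moreover have "c b s \<in> carrier K" for s
        using A_coeff_closed[OF a] by (simp add: c_def)
      ultimately have "c b \<in> carrier A"
        unfolding carrier_A using out \<phi> by blast
      then show "c b \<in> ?F" unfolding supported_def using out by blast
    qed
    have "a = (\<Oplus>\<^bsub>A\<^esub>b\<in>e ` I. op b (c b))"
    proof
      fix s show "a s = (\<Oplus>\<^bsub>A\<^esub>b\<in>e ` I. op b (c b)) s"
      proof (cases "s \<in> carrier S")
        case True
        then have "s \<in> (\<lambda>(i, t). p i t) ` (I \<times> carrier T)"
          using bij_betw_imp_surj_on[OF bij] by simp
        then obtain j t where "j \<in> I" "t \<in> carrier T" "s = p j t" by fastforce
        then show ?thesis using eval[OF c] c_\<phi> by simp
      next
        case False
        then show ?thesis using A_outside[OF a] A_outside[OF sum_A[OF c]] by metis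
      qed
    qed
    with c show "\<exists>c\<in>e ` I \<rightarrow> ?F. a = (\<Oplus>\<^bsub>A\<^esub>b\<in>e ` I. op b (c b))" by blast
  next
    fix c b assume c: "c \<in> e ` I \<rightarrow> ?F" and zero: "(\<Oplus>\<^bsub>A\<^esub>b\<in>e ` I. op b (c b)) = \<zero>\<^bsub>A\<^esub>"
      and "b \<in> e ` I"
    then obtain j where j: "j \<in> I" "b = e j" by blast
    show "c b = \<zero>\<^bsub>A\<^esub>"
      unfolding A_operations
    proof
      fix s show "c b s = \<zero>"
      proof (cases "s \<in> \<phi> ` carrier T")
        case True
        then obtain t where t: "t \<in> carrier T" "s = \<phi> t" by blast
        show ?thesis using eval[OF c j(1) t(1)] unfolding zero A_operations j t(2) by simp
      next
        case False
        then show ?thesis using c j by (auto simp: supported_def)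
      qed
    qed
  }
qed

text \<open>
  Multiplication by a basis element shifts a coefficient function: when \<open>s \<otimes> v = x\<close> has at most
  the solution \<open>w\<close> in \<open>W\<close>, only one term of the convolution survives. The proposition \<open>P\<close> says
  whether the solution exists.
\<close>

lemma single_mult_coordinate:
  assumes W: "W \<subseteq> carrier S" and s: "s \<in> carrier S" and w: "w \<in> W" and c: "c \<in> supported W"
    and inj: "\<And>v. v \<in> W \<Longrightarrow> s \<otimes>\<^bsub>S\<^esub> v = x \<longleftrightarrow> P \<and> v = w"
  shows "(single \<one> s \<otimes>\<^bsub>A\<^esub> c) x = (if P then c w else \<zero>)"
proof -
  have iff: "u \<in> carrier S \<and> v \<in> carrier S \<and> single \<one> s u \<noteq> \<zero> \<and> c v \<noteq> \<zero> \<and> u \<otimes>\<^bsub>S\<^esub> v = x \<longleftrightarrow>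
      P \<and> c w \<noteq> \<zero> \<and> u = s \<and> v = w" for u v
  proof (cases "u = s \<and> c v \<noteq> \<zero>")
    case True
    then have "v \<in> W" using c by (simp add: supported_def)
    then show ?thesis using True inj[of v] s w W by (auto simp: single_def)
  next
    case False
    then show ?thesis using c by (auto simp: single_def)
  qed
  have "{(u, v). u \<in> carrier S \<and> v \<in> carrier S \<and> single \<one> s u \<noteq> \<zero> \<and> c v \<noteq> \<zero> \<and> u \<otimes>\<^bsub>S\<^esub> v = x} =
      (if P \<and> c w \<noteq> \<zero> then {(s, w)} else {})"
    unfolding iff by auto
  moreover have "c w \<in> carrier K" using c A_coeff_closed by (auto simp: supported_def)
  ultimately show ?thesis
    unfolding mult_A by (auto simp: single_def)
qed

lemma mult_single_coordinate:
  assumes W: "W \<subseteq> carrier S" and s: "s \<in> carrier S" and w: "w \<in> W" and c: "c \<in> supported W"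
    and inj: "\<And>v. v \<in> W \<Longrightarrow> v \<otimes>\<^bsub>S\<^esub> s = x \<longleftrightarrow> P \<and> v = w"
  shows "(c \<otimes>\<^bsub>A\<^esub> single \<one> s) x = (if P then c w else \<zero>)"
proof -
  have iff: "u \<in> carrier S \<and> v \<in> carrier S \<and> c u \<noteq> \<zero> \<and> single \<one> s v \<noteq> \<zero> \<and> u \<otimes>\<^bsub>S\<^esub> v = x \<longleftrightarrow>
      P \<and> c w \<noteq> \<zero> \<and> u = w \<and> v = s" for u v
  proof (cases "v = s \<and> c u \<noteq> \<zero>")
    case True
    then have "u \<in> W" using c by (simp add: supported_def)
    then show ?thesis using True inj[of u] s w W by (auto simp: single_def)
  next
    case False
    then show ?thesis using c by (auto simp: single_def)
  qed
  have "{(u, v). u \<in> carrier S \<and> v \<in> carrier S \<and> c u \<noteq> \<zero> \<and> single \<one> s v \<noteq> \<zero> \<and> u \<otimes>\<^bsub>S\<^esub> v = x} =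
      (if P \<and> c w \<noteq> \<zero> then {(w, s)} else {})"
    unfolding iff by auto
  moreover have "c w \<in> carrier K" using c A_coeff_closed by (auto simp: supported_def)
  ultimately show ?thesis
    unfolding mult_A by (auto simp: single_def)
qed

text \<open>
  Unique factorisation \<open>m i \<otimes> \<phi> t\<close> makes \<open>S\<close> a free right act over the submonoid \<open>\<phi>(T)\<close> with
  basis \<open>m\<close>; linearising it gives a free right module with the same basis.
\<close>

lemma free_act_fg_free_right_module:
  fixes T :: "('t, 'q) monoid_scheme"
  assumes T: "monoid T" and I: "finite I" "m ` I \<subseteq> carrier S"
    and \<phi>: "\<phi> \<in> hom T S" "\<phi> \<one>\<^bsub>T\<^esub> = \<one>\<^bsub>S\<^esub>" "inj_on \<phi> (carrier T)"
    and bij: "bij_betw (\<lambda>(i, t). m i \<otimes>\<^bsub>S\<^esub> \<phi> t) (I \<times> carrier T) (carrier S)"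
  shows "fg_free_right_module A (supported (\<phi> ` carrier T))"
  unfolding fg_free_right_module_def
proof (rule fg_free_by_coordinates[where e = "\<lambda>i. single \<one> (m i)", OF I(1) \<phi>(3) _ bij])
  interpret T: monoid T by (rule T)
  show W: "\<phi> ` carrier T \<subseteq> carrier S" using \<phi>(1) by (auto simp: hom_def)
  have inj: "i = j \<and> t = u" if "i \<in> I" "j \<in> I" "t \<in> carrier T" "u \<in> carrier T"
    "m i \<otimes>\<^bsub>S\<^esub> \<phi> t = m j \<otimes>\<^bsub>S\<^esub> \<phi> u" for i j t u
    using inj_onD[OF bij_betw_imp_inj_on[OF bij], of "(i, t)" "(j, u)"] that by simp
  have "inj_on m I"
  proof (rule inj_onI)
    fix i j assume "i \<in> I" "j \<in> I" "m i = m j"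
    then show "i = j" using inj[of i j "\<one>\<^bsub>T\<^esub>" "\<one>\<^bsub>T\<^esub>"] by simp
  qed
  from comp_inj_on[OF this inj_single] show "inj_on (\<lambda>i. single \<one> (m i)) I"
    unfolding comp_def .
  show "(\<lambda>i. single \<one> (m i)) ` I \<subseteq> carrier A" using I(2) by auto
  show "single \<one> (m i) \<otimes>\<^bsub>A\<^esub> c \<in> carrier A" if "i \<in> I" "c \<in> supported (\<phi> ` carrier T)" for i c
    using that I(2) by (intro A_mult_closed) (auto simp: supported_def)
  show "(single \<one> (m i) \<otimes>\<^bsub>A\<^esub> c) (m j \<otimes>\<^bsub>S\<^esub> \<phi> t) = (if i = j then c (\<phi> t) else \<zero>)"
    if "i \<in> I" "j \<in> I" "c \<in> supported (\<phi> ` carrier T)" "t \<in> carrier T" for i j c t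
  proof (rule single_mult_coordinate[OF W])
    show "m i \<in> carrier S" using that I(2) by blast
    show "\<phi> t \<in> \<phi> ` carrier T" using that by blast
    show "c \<in> supported (\<phi> ` carrier T)" by (rule that)
    fix v assume "v \<in> \<phi> ` carrier T"
    then obtain u where "u \<in> carrier T" "v = \<phi> u" by blast
    then show "m i \<otimes>\<^bsub>S\<^esub> v = m j \<otimes>\<^bsub>S\<^esub> \<phi> t \<longleftrightarrow> i = j \<and> v = \<phi> t"
      using inj[of i j u t] that by auto
  qed
qed

lemma free_act_fg_free_left_module:
  fixes T :: "('t, 'q) monoid_scheme"
  assumes T: "monoid T" and I: "finite I" "m ` I \<subseteq> carrier S"
    and \<phi>: "\<phi> \<in> hom T S" "\<phi> \<one>\<^bsub>T\<^esub> = \<one>\<^bsub>S\<^esub>" "inj_on \<phi> (carrier T)"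
    and bij: "bij_betw (\<lambda>(i, t). \<phi> t \<otimes>\<^bsub>S\<^esub> m i) (I \<times> carrier T) (carrier S)"
  shows "fg_free_left_module A (supported (\<phi> ` carrier T))"
  unfolding fg_free_left_module_def
proof (rule fg_free_by_coordinates[where e = "\<lambda>i. single \<one> (m i)" and op = "\<lambda>b c. c \<otimes>\<^bsub>A\<^esub> b",
    OF I(1) \<phi>(3) _ bij])
  interpret T: monoid T by (rule T)
  show W: "\<phi> ` carrier T \<subseteq> carrier S" using \<phi>(1) by (auto simp: hom_def)
  have inj: "i = j \<and> t = u" if "i \<in> I" "j \<in> I" "t \<in> carrier T" "u \<in> carrier T"
    "\<phi> t \<otimes>\<^bsub>S\<^esub> m i = \<phi> u \<otimes>\<^bsub>S\<^esub> m j" for i j t u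
    using inj_onD[OF bij_betw_imp_inj_on[OF bij], of "(i, t)" "(j, u)"] that by simp
  have "inj_on m I"
  proof (rule inj_onI)
    fix i j assume "i \<in> I" "j \<in> I" "m i = m j"
    then show "i = j" using inj[of i j "\<one>\<^bsub>T\<^esub>" "\<one>\<^bsub>T\<^esub>"] by simp
  qed
  from comp_inj_on[OF this inj_single] show "inj_on (\<lambda>i. single \<one> (m i)) I"
    unfolding comp_def .
  show "(\<lambda>i. single \<one> (m i)) ` I \<subseteq> carrier A" using I(2) by auto
  show "c \<otimes>\<^bsub>A\<^esub> single \<one> (m i) \<in> carrier A" if "i \<in> I" "c \<in> supported (\<phi> ` carrier T)" for i c
    using that I(2) by (intro A_mult_closed) (auto simp: supported_def)
  show "(c \<otimes>\<^bsub>A\<^esub> single \<one> (m i)) (\<phi> t \<otimes>\<^bsub>S\<^esub> m j) = (if i = j then c (\<phi> t) else \<zero>)"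
    if "i \<in> I" "j \<in> I" "c \<in> supported (\<phi> ` carrier T)" "t \<in> carrier T" for i j c t
  proof (rule mult_single_coordinate[OF W])
    show "m i \<in> carrier S" using that I(2) by blast
    show "\<phi> t \<in> \<phi> ` carrier T" using that by blast
    show "c \<in> supported (\<phi> ` carrier T)" by (rule that)
    fix v assume "v \<in> \<phi> ` carrier T"
    then obtain u where "u \<in> carrier T" "v = \<phi> u" by blast
    then show "v \<otimes>\<^bsub>S\<^esub> m i = \<phi> t \<otimes>\<^bsub>S\<^esub> m j \<longleftrightarrow> i = j \<and> v = \<phi> t"
      using inj[of i j u t] that by auto
  qed
qed

section \<open>Growth of monoid algebras\<close>

abbreviation pow :: "('s \<Rightarrow> 'k) set \<Rightarrow> nat \<Rightarrow> ('s \<Rightarrow> 'k) set" where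
  "pow V m \<equiv> subspace_power K A V m"

text \<open>
  Used to pass from generators to spans: an inclusion \<open>a b \<in> N\<close> for all \<open>b\<close> in a spanning set
  extends to the whole span.
\<close>

lemma submodule_mult_preimage:
  assumes N: "submodule K N A" and a: "a \<in> carrier A"
  shows "submodule K {b \<in> carrier A. a \<otimes>\<^bsub>A\<^esub> b \<in> N} A" (is ?left)
    and "submodule K {b \<in> carrier A. b \<otimes>\<^bsub>A\<^esub> a \<in> N} A" (is ?right)
proof -
  note closed = submodule.m_closed[OF N] submodule.zero_closed[OF N] submodule.smult_closed[OF N]
  show ?left
    by (rule submodule.intro[OF A.module_axioms])
      (use closed a A_zero_closed in \<open>auto simp only: mem_Collect_eq A_add_closed A_smult_closed
        A_r_distr A_zero_mult A_smult_mult\<close>)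
  show ?right
    by (rule submodule.intro[OF A.module_axioms])
      (use closed a A_zero_closed in \<open>auto simp only: mem_Collect_eq A_add_closed A_smult_closed
        A_l_distr A_zero_mult A_smult_mult\<close>)
qed

lemma pow_subspace:
  assumes V: "V \<subseteq> carrier A"
  shows "subspace K (pow V m) A"
proof (induction m)
  case 0
  then show ?case
    using A.span_is_subspace[of "{\<one>\<^bsub>A\<^esub>}"] by (simp add: one_A)
next
  case (Suc m)
  then have "pow V m \<subseteq> carrier A"
    using A.is_module submodule.subset by blast
  then have "{a \<otimes>\<^bsub>A\<^esub> v |a v. a \<in> pow V m \<and> v \<in> V} \<subseteq> carrier A"
    using V A_mult_closed by blast
  from A.span_is_subspace[OF this] show ?case by simp
qed

lemma pow_submodule: "V \<subseteq> carrier A \<Longrightarrow> submodule K (pow V m) A"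
  using pow_subspace A.is_module by blast

lemma pow_closed: "V \<subseteq> carrier A \<Longrightarrow> pow V m \<subseteq> carrier A"
  using pow_submodule submodule.subset by blast

lemma one_in_pow_0: "\<one>\<^bsub>A\<^esub> \<in> pow V 0"
  using A.in_own_span[of "{\<one>\<^bsub>A\<^esub>}"] by (simp add: one_A)

lemma pow_SucI:
  assumes V: "V \<subseteq> carrier A" and "a \<in> pow V m" "v \<in> V"
  shows "a \<otimes>\<^bsub>A\<^esub> v \<in> pow V (Suc m)"
proof -
  have "{a \<otimes>\<^bsub>A\<^esub> v |a v. a \<in> pow V m \<and> v \<in> V} \<subseteq> carrier A"
    using V pow_closed[OF V] A_mult_closed by blast
  from A.in_own_span[OF this] show ?thesis using assms(2,3) by auto
qed

lemma pow_mult: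
  assumes V: "V \<subseteq> carrier A" and a: "a \<in> pow V i" and b: "b \<in> pow V j"
  shows "a \<otimes>\<^bsub>A\<^esub> b \<in> pow V (i + j)"
  using b
proof (induction j arbitrary: b)
  case 0
  have aA: "a \<in> carrier A" using a pow_closed[OF V] by blast
  have "A.span {\<one>\<^bsub>A\<^esub>} \<subseteq> {b \<in> carrier A. a \<otimes>\<^bsub>A\<^esub> b \<in> pow V i}"
    by (rule A.span_is_subset[OF _ submodule_mult_preimage(1)[OF pow_submodule[OF V] aA]])
      (use a aA A_one_mult in \<open>auto simp: one_A\<close>)
  then show ?case using 0 by auto
next
  case (Suc j)
  have aA: "a \<in> carrier A" using a pow_closed[OF V] by blast
  have "A.span {b \<otimes>\<^bsub>A\<^esub> v |b v. b \<in> pow V j \<and> v \<in> V} \<subseteq>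
      {b \<in> carrier A. a \<otimes>\<^bsub>A\<^esub> b \<in> pow V (i + Suc j)}"
  proof (rule A.span_is_subset[OF _ submodule_mult_preimage(1)[OF pow_submodule[OF V] aA]])
    show "{b \<otimes>\<^bsub>A\<^esub> v |b v. b \<in> pow V j \<and> v \<in> V} \<subseteq>
        {b \<in> carrier A. a \<otimes>\<^bsub>A\<^esub> b \<in> pow V (i + Suc j)}"
    proof clarify
      fix b v assume b: "b \<in> pow V j" and v: "v \<in> V"
      have bv: "b \<in> carrier A" "v \<in> carrier A" using b v V pow_closed[OF V] by auto
      have "(a \<otimes>\<^bsub>A\<^esub> b) \<otimes>\<^bsub>A\<^esub> v \<in> pow V (Suc (i + j))"
        by (rule pow_SucI[OF V Suc.IH[OF b] v])
      then have "a \<otimes>\<^bsub>A\<^esub> (b \<otimes>\<^bsub>A\<^esub> v) \<in> pow V (i + Suc j)"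
        using A_assoc[OF aA bv] by (simp only: add_Suc_right)
      then show "b \<otimes>\<^bsub>A\<^esub> v \<in> carrier A \<and> a \<otimes>\<^bsub>A\<^esub> (b \<otimes>\<^bsub>A\<^esub> v) \<in> pow V (i + Suc j)"
        using A_mult_closed[OF bv] by blast
    qed
  qed
  then show ?case using Suc.prems by auto
qed

lemma pow_mono:
  assumes V: "V \<subseteq> carrier A" "\<one>\<^bsub>A\<^esub> \<in> V" and "i \<le> j"
  shows "pow V i \<subseteq> pow V j"
  using assms(3)
proof (induction j rule: dec_induct)
  case (step j)
  have "a \<in> pow V (Suc j)" if "a \<in> pow V j" for a
    using pow_SucI[OF V(1) that V(2)] A_one_mult(2)[OF subsetD[OF pow_closed[OF V(1)] that]]
    by (simp only:)
  then show ?case using step.IH by blast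
qed simp

text \<open>
  The union of the ascending chain of powers is closed under products, since \<open>V\<^sup>i V\<^sup>j\<close> lies in
  \<open>V\<^sup>i\<^sup>+\<^sup>j\<close>, so it is a subalgebra containing \<open>V\<close>.
\<close>

lemma pow_exhausts:
  assumes V: "generating_subspace K A V" and f: "f \<in> carrier A"
  shows "\<exists>m. f \<in> pow V m"
proof -
  have VA: "V \<subseteq> carrier A" "\<one>\<^bsub>A\<^esub> \<in> V"
    using V A.is_module submodule.subset unfolding generating_subspace_def by blast+
  have "submodule K (\<Union>m\<in>UNIV. pow V m) A"
  proof (rule A.nested_union_vs[OF _ _ HOL.refl])
    show "submodule K (pow V m) A" for m by (rule pow_submodule[OF VA(1)])
    show "\<exists>k. k \<in> UNIV \<and> pow V i \<subseteq> pow V k \<and> pow V j \<subseteq> pow V k" for i j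
      using pow_mono[OF VA, of i "max i j"] pow_mono[OF VA, of j "max i j"] by auto
  qed simp
  then have "subspace K (\<Union>m\<in>UNIV. pow V m) A"
    by (rule subspace.intro[OF A.vectorspace_axioms])
  moreover have "\<one>\<^bsub>A\<^esub> \<in> (\<Union>m\<in>UNIV. pow V m)" using one_in_pow_0 by blast
  moreover have "a \<otimes>\<^bsub>A\<^esub> b \<in> (\<Union>m\<in>UNIV. pow V m)"
    if "a \<in> (\<Union>m\<in>UNIV. pow V m)" "b \<in> (\<Union>m\<in>UNIV. pow V m)" for a b
    using that pow_mult[OF VA(1)] by blast
  ultimately have "subalg K A (\<Union>m\<in>UNIV. pow V m)"
    unfolding subalg_def by blast
  moreover have "V \<subseteq> (\<Union>m\<in>UNIV. pow V m)"
  proof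
    fix v assume v: "v \<in> V"
    have "\<one>\<^bsub>A\<^esub> \<otimes>\<^bsub>A\<^esub> v \<in> pow V (Suc 0)"
      by (rule pow_SucI[OF VA(1) one_in_pow_0 v])
    then have "v \<in> pow V (Suc 0)"
      using A_one_mult(1)[OF subsetD[OF VA(1) v]] by (simp only:)
    then show "v \<in> (\<Union>m\<in>UNIV. pow V m)" by blast
  qed
  ultimately have "alg_generated K A V \<subseteq> (\<Union>m\<in>UNIV. pow V m)"
    unfolding alg_generated_def by blast
  then show ?thesis using V f unfolding generating_subspace_def by blast
qed

lemma fin_dim_subspace_iff:
  assumes "subspace K N A"
  shows "vectorspace.fin_dim K (A\<lparr>carrier := N\<rparr>) \<longleftrightarrow> (\<exists>Q. finite Q \<and> Q \<subseteq> N \<and> A.span Q = N)"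
proof -
  interpret N: vectorspace K "A\<lparr>carrier := N\<rparr>"
    by (rule A.subspace_is_vs[OF assms])
  show ?thesis
    unfolding N.fin_dim_def
    using A.span_li_not_depend(1)[OF _ A.is_module[OF assms]] by auto
qed

text \<open>
  The dimension is the least size of a finite generating set, so linearly independent sets bound
  it from below only once a finite generating set is known to exist. Products of generators of
  \<open>V\<^sup>m\<close> and of \<open>V\<close> generate the next power.
\<close>

lemma pow_fin_dim:
  assumes V: "subspace K V A" "vectorspace.fin_dim K (A\<lparr>carrier := V\<rparr>)"
  shows "vectorspace.fin_dim K (A\<lparr>carrier := pow V m\<rparr>)"
proof -
  have VA: "V \<subseteq> carrier A" using V(1) A.is_module submodule.subset by blast
  obtain Q where Q: "finite Q" "Q \<subseteq> V" "A.span Q = V"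
    using V fin_dim_subspace_iff by blast
  have QA: "Q \<subseteq> carrier A" using Q VA by blast
  have "\<exists>P. finite P \<and> P \<subseteq> pow V m \<and> A.span P = pow V m"
  proof (induction m)
    case 0
    then show ?case using one_in_pow_0[of V] by (intro exI[of _ "{\<one>\<^bsub>A\<^esub>}"]) simp
  next
    case (Suc m)
    then obtain P where P: "finite P" "P \<subseteq> pow V m" "A.span P = pow V m" by blast
    have PA: "P \<subseteq> carrier A" using P pow_closed[OF VA] by blast
    define R where "R = (\<lambda>(p, q). p \<otimes>\<^bsub>A\<^esub> q) ` (P \<times> Q)"
    have "p \<otimes>\<^bsub>A\<^esub> q \<in> pow V (Suc m)" if "p \<in> P" "q \<in> Q" for p q
      by (rule pow_SucI[OF VA subsetD[OF P(2) that(1)] subsetD[OF Q(2) that(2)]])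
    then have R: "finite R" "R \<subseteq> pow V (Suc m)"
      using P(1) Q(1) unfolding R_def image_subset_iff by (blast, fast)
    have RA: "R \<subseteq> carrier A" using R(2) pow_closed[OF VA] by blast
    note spR = A.is_module[OF A.span_is_subspace[OF RA]]
    have 1: "pow V m \<subseteq> {a \<in> carrier A. a \<otimes>\<^bsub>A\<^esub> q \<in> A.span R}" if "q \<in> Q" for q
      unfolding P(3)[symmetric]
    proof (rule A.span_is_subset[OF _ submodule_mult_preimage(2)[OF spR]])
      show "P \<subseteq> {a \<in> carrier A. a \<otimes>\<^bsub>A\<^esub> q \<in> A.span R}"
        using A.in_own_span[OF RA] PA that unfolding R_def by auto
      show "q \<in> carrier A" using that QA by blast
    qed
    have 2: "V \<subseteq> {v \<in> carrier A. a \<otimes>\<^bsub>A\<^esub> v \<in> A.span R}" if "a \<in> pow V m" for a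
    proof -
      have "A.span Q \<subseteq> {v \<in> carrier A. a \<otimes>\<^bsub>A\<^esub> v \<in> A.span R}"
      proof (rule A.span_is_subset[OF _ submodule_mult_preimage(1)[OF spR]])
        show "Q \<subseteq> {v \<in> carrier A. a \<otimes>\<^bsub>A\<^esub> v \<in> A.span R}" using 1 that QA by blast
        show "a \<in> carrier A" using that pow_closed[OF VA] by blast
      qed
      then show ?thesis unfolding Q(3) .
    qed
    have "pow V (Suc m) \<subseteq> A.span R"
      unfolding subspace_power.simps by (rule A.span_is_subset[OF _ spR]) (use 2 in blast)
    moreover have "A.span R \<subseteq> pow V (Suc m)"
      by (rule A.span_is_subset[OF R(2) pow_submodule[OF VA]])
    ultimately show ?case using R by blast
  qed
  then show ?thesis using fin_dim_subspace_iff[OF pow_subspace[OF VA]] by blast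
qed

lemma singles_lin_indpt:
  assumes L: "finite L" "L \<subseteq> carrier S"
  shows "A.lin_indpt (single \<one> ` L)"
proof (rule A.finite_lin_indpt2)
  show "finite (single \<one> ` L)" "single \<one> ` L \<subseteq> carrier A" using L by auto
  fix a assume a: "a \<in> single \<one> ` L \<rightarrow> carrier K" and zero: "A.lincomb a (single \<one> ` L) = \<zero>\<^bsub>A\<^esub>"
  have aK: "a (single \<one> s) \<in> carrier K" if "s \<in> L" for s using a that by blast
  show "\<forall>v\<in>single \<one> ` L. a v = \<zero>"
  proof clarify
    fix s assume s: "s \<in> L"
    have "\<zero> = A.lincomb a (single \<one> ` L) s" unfolding zero A_operations ..
    also have "\<dots> = (\<Oplus>v\<in>single \<one> ` L. (a v \<odot>\<^bsub>A\<^esub> v) s)"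
      unfolding A.lincomb_def
      by (rule finsum_A_apply) (use L a in \<open>auto intro!: A_smult_closed\<close>)
    also have "\<dots> = (\<Oplus>t\<in>L. (a (single \<one> t) \<odot>\<^bsub>A\<^esub> single \<one> t) s)"
      by (rule K.finsum_reindex[OF _ inj_single]) (use L aK in \<open>auto simp: A_operations single_def\<close>)
    also have "\<dots> = (\<Oplus>t\<in>L. if s = t then a (single \<one> t) else \<zero>)"
      by (rule K.finsum_cong') (use aK in \<open>auto simp: A_operations single_def\<close>)
    also have "\<dots> = a (single \<one> s)"
      by (rule K.finsum_singleton[OF s L(1)]) (use aK in blast)
    finally show "a (single \<one> s) = \<zero>" by simp
  qed
qed

lemma card_le_dim_pow:
  assumes V: "subspace K V A" "vectorspace.fin_dim K (A\<lparr>carrier := V\<rparr>)"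
    and L: "finite L" "L \<subseteq> carrier S" "single \<one> ` L \<subseteq> pow V m"
  shows "card L \<le> vectorspace.dim K (A\<lparr>carrier := pow V m\<rparr>)"
proof -
  have VA: "V \<subseteq> carrier A" using V(1) A.is_module submodule.subset by blast
  interpret P: vectorspace K "A\<lparr>carrier := pow V m\<rparr>"
    by (rule A.subspace_is_vs[OF pow_subspace[OF VA]])
  have "P.lin_indpt (single \<one> ` L)"
    using singles_lin_indpt[OF L(1,2)] A.span_li_not_depend(2)[OF L(3) pow_submodule[OF VA]] by simp
  then have "card (single \<one> ` L) \<le> P.dim"
    using P.li_le_dim(2)[OF pow_fin_dim[OF V]] L(3) by simp
  then show ?thesis by (simp add: card_image[OF inj_single])
qed

text \<open>
  The generating set \<open>G\<close> gives a generating subspace. The lower bound comes from a free submonoid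
  of rank two, the image of the injective homomorphism \<open>\<psi>\<close> from words over two letters.
\<close>

lemma exponential_growth_of_free_submonoid:
  assumes G: "finite G" "G \<subseteq> carrier S"
    and gen: "\<And>F. \<one>\<^bsub>S\<^esub> \<in> F \<Longrightarrow> (\<And>s g. s \<in> F \<Longrightarrow> g \<in> G \<Longrightarrow> s \<otimes>\<^bsub>S\<^esub> g \<in> F) \<Longrightarrow> carrier S \<subseteq> F"
    and \<psi>: "\<psi> \<in> hom (free_monoid (UNIV :: bool set)) S" "\<psi> [] = \<one>\<^bsub>S\<^esub>" "inj \<psi>"
  shows "exponential_growth K A"
  unfolding exponential_growth_def
proof (intro conjI allI impI)
  define Q where "Q = single \<one> ` insert \<one>\<^bsub>S\<^esub> G"
  have Q: "finite Q" "Q \<subseteq> carrier A" using G unfolding Q_def by auto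
  have sub: "subspace K (A.span Q) A" by (rule A.span_is_subspace[OF Q(2)])
  have QV: "Q \<subseteq> A.span Q" by (rule A.in_own_span[OF Q(2)])
  have "submodule K (carrier A) A"
    by (rule submodule.intro[OF A.module_axioms])
      (auto intro: A_add_closed A_smult_closed A_zero_closed)
  then have "subalg K A (carrier A)"
    unfolding subalg_def using subspace.intro[OF A.vectorspace_axioms] A_mult_closed
    by (auto simp: one_A)
  moreover have "A.span Q \<subseteq> carrier A" by (rule A.span_is_subset2[OF Q(2)])
  ultimately have "alg_generated K A (A.span Q) \<subseteq> carrier A"
    unfolding alg_generated_def by blast
  moreover have "carrier A \<subseteq> F" if F: "subalg K A F" "A.span Q \<subseteq> F" for F
  proof
    have QF: "Q \<subseteq> F" using QV F(2) by blast
    have Fsub: "submodule K F A" using F(1) A.is_module unfolding subalg_def by blast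
    have "carrier S \<subseteq> {s \<in> carrier S. single \<one> s \<in> F}"
    proof (rule gen)
      show "\<one>\<^bsub>S\<^esub> \<in> {s \<in> carrier S. single \<one> s \<in> F}" using QF by (auto simp: Q_def)
    next
      fix s g assume s: "s \<in> {s \<in> carrier S. single \<one> s \<in> F}" and g: "g \<in> G"
      have "single \<one> s \<otimes>\<^bsub>A\<^esub> single \<one> g \<in> F"
        using F(1) s g QF unfolding subalg_def Q_def by blast
      then show "s \<otimes>\<^bsub>S\<^esub> g \<in> {s \<in> carrier S. single \<one> s \<in> F}"
        using s g G(2) single_mult_single[of \<one> \<one> s g] by auto
    qed
    then have single_F: "single c s \<in> F" if "c \<in> carrier K" "s \<in> carrier S" for c s
      using submodule.smult_closed[OF Fsub that(1), of "single \<one> s"] smult_single[OF that(1) K.one_closed, of s] that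
      by auto
    fix f assume "f \<in> carrier A"
    then show "f \<in> F"
      by (induction f rule: A_induct)
        (use single_F submodule.m_closed[OF Fsub] submodule.zero_closed[OF Fsub] in blast)+
  qed
  then have "carrier A \<subseteq> alg_generated K A (A.span Q)"
    unfolding alg_generated_def by blast
  ultimately have gen: "alg_generated K A (A.span Q) = carrier A" by (rule equalityI)
  have fd: "vectorspace.fin_dim K (A\<lparr>carrier := A.span Q\<rparr>)"
    using fin_dim_subspace_iff[OF sub] Q(1) QV by blast
  have "\<one>\<^bsub>A\<^esub> \<in> Q" unfolding one_A Q_def by blast
  then have "\<one>\<^bsub>A\<^esub> \<in> A.span Q" using QV by blast
  with sub fd gen have "generating_subspace K A (A.span Q)"
    unfolding generating_subspace_def by blast
  then show "\<exists>V. generating_subspace K A V" by blast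
next
  fix V assume V: "generating_subspace K A V"
  then have sub: "subspace K V A" and fd: "vectorspace.fin_dim K (A\<lparr>carrier := V\<rparr>)"
    and one: "\<one>\<^bsub>A\<^esub> \<in> V"
    unfolding generating_subspace_def by auto
  have VA: "V \<subseteq> carrier A" using sub A.is_module submodule.subset by blast
  have \<psi>_closed: "\<psi> w \<in> carrier S" for w
    using \<psi>(1) by (auto simp: hom_def free_monoid_def)
  have \<psi>_append: "\<psi> (u @ v) = \<psi> u \<otimes>\<^bsub>S\<^esub> \<psi> v" for u v
    using \<psi>(1) by (auto simp: hom_def free_monoid_def)
  obtain k1 k2 where k12: "single \<one> (\<psi> [True]) \<in> pow V k1" "single \<one> (\<psi> [False]) \<in> pow V k2"
    using pow_exhausts[OF V single_in_A[OF K.one_closed \<psi>_closed]] by metis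
  \<comment> \<open>The successor keeps \<open>k\<close> positive.\<close>
  define k where "k = Suc (max k1 k2)"
  have "k1 \<le> k" "k2 \<le> k" by (simp_all add: k_def)
  note letters = subsetD[OF pow_mono[OF VA one this(1)] k12(1)]
    subsetD[OF pow_mono[OF VA one this(2)] k12(2)]
  have k: "single \<one> (\<psi> [x]) \<in> pow V k" for x
    by (cases x) (simp_all only: letters)
  have words: "single \<one> (\<psi> w) \<in> pow V (k * length w)" for w
  proof (induction w)
    case Nil
    then show ?case using one_in_pow_0[of V] \<psi>(2) by (simp only: one_A list.size mult_0_right)
  next
    case (Cons x w)
    have "single \<one> (\<psi> [x]) \<otimes>\<^bsub>A\<^esub> single \<one> (\<psi> w) \<in> pow V (k + k * length w)"
      by (rule pow_mult[OF VA k Cons.IH])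
    moreover have "single \<one> (\<psi> [x]) \<otimes>\<^bsub>A\<^esub> single \<one> (\<psi> w) = single \<one> (\<psi> (x # w))"
      using \<psi>_append[of "[x]" w] \<psi>_closed by (simp add: single_mult_single)
    ultimately show ?case by (simp only: list.size mult_Suc_right add_Suc_right add_0_right)
  qed
  show "1 < limsup (\<lambda>m. ereal (root m (real (vectorspace.dim K (A\<lparr>carrier := pow V m\<rparr>)))))"
  proof (rule limsup_root_exponential)
    show "k \<ge> 1" by (simp add: k_def)
    fix m
    let ?W = "{w :: bool list. length w = m}"
    have W: "finite ?W" "card ?W = 2 ^ m"
      using card_lists_length_eq[of "UNIV :: bool set" m] finite_lists_length_eq[of "UNIV :: bool set" m]
      by simp_all
    have "card (\<psi> ` ?W) \<le> vectorspace.dim K (A\<lparr>carrier := pow V (k * m)\<rparr>)"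
      by (rule card_le_dim_pow[OF sub fd]) (use W \<psi>_closed words in auto)
    moreover have "card (\<psi> ` ?W) = 2 ^ m"
      using card_image[of \<psi> ?W] W \<psi>(3) inj_on_subset by fastforce
    ultimately show "2 ^ m \<le> vectorspace.dim K (A\<lparr>carrier := pow V (k * m)\<rparr>)" by simp
  qed
qed

end

section \<open>Words and permutation relations\<close>

lemma monoid_free_monoid: "monoid (free_monoid Y)"
  by (rule monoidI) (auto simp: free_monoid_def)

lemma word_cong_rev:
  assumes "\<And>u v. (u, v) \<in> R \<Longrightarrow> (rev u, rev v) \<in> word_cong X R"
    and "(u, v) \<in> word_cong X R"
  shows "(rev u, rev v) \<in> word_cong X R"
  using assms(2)
proof induction
  case (base u v)
  then show ?case using assms(1) by blast
qed (auto intro: word_cong.intros)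

locale perm_presentation =
  fixes n l :: nat and H :: "(nat \<Rightarrow> nat) set"
  assumes subgroup_H: "subgroup H (sym_group n)"
begin

abbreviation X :: "nat set" where "X \<equiv> {1..n}"

abbreviation cong :: "(nat list \<times> nat list) set" where
  "cong \<equiv> word_cong X (perm_rels n l H)"

lemma H_permutes: "\<sigma> \<in> H \<Longrightarrow> \<sigma> permutes X"
  using subgroup.subset[OF subgroup_H] by (auto simp: sym_group_carrier)

lemma H_id: "id \<in> H"
  using subgroup.one_closed[OF subgroup_H] by (simp add: sym_group_one)

lemma H_comp: "\<sigma> \<in> H \<Longrightarrow> \<tau> \<in> H \<Longrightarrow> \<sigma> \<circ> \<tau> \<in> H"
  using subgroup.m_closed[OF subgroup_H] by (simp add: sym_group_mult)

lemma H_inverse: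
  assumes "\<sigma> \<in> H" obtains \<tau> where "\<tau> \<in> H" "\<tau> \<circ> \<sigma> = id" "\<sigma> \<circ> \<tau> = id"
proof -
  interpret G: group "sym_group n" by (rule sym_group_is_group)
  have "\<sigma> \<in> carrier (sym_group n)"
    using assms subgroup.subset[OF subgroup_H] by auto
  then have "inv\<^bsub>sym_group n\<^esub> \<sigma> \<circ> \<sigma> = id" "\<sigma> \<circ> inv\<^bsub>sym_group n\<^esub> \<sigma> = id"
    using G.l_inv[of \<sigma>] G.r_inv[of \<sigma>] by (simp_all add: sym_group_mult sym_group_one)
  then show thesis
    using that subgroup.m_inv_closed[OF subgroup_H assms] by blast
qed

lemma H_mem: "\<sigma> \<in> H \<Longrightarrow> x \<in> X \<Longrightarrow> \<sigma> x \<in> X"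
  using permutes_in_image[OF H_permutes] by blast

lemma H_lists: "\<sigma> \<in> H \<Longrightarrow> w \<in> lists X \<Longrightarrow> map \<sigma> w \<in> lists X"
  using H_mem by (induction w) auto

lemma cong_map:
  assumes "\<sigma> \<in> H" "w \<in> lists X" "length w = l"
  shows "(w, map \<sigma> w) \<in> cong"
  using assms H_lists[OF assms(1,2)] by (intro word_cong.base) (auto simp: perm_rels_def)

lemma cong_rev:
  assumes "(u, v) \<in> cong"
  shows "(rev u, rev v) \<in> cong"
proof (rule word_cong_rev[OF _ assms])
  fix u v assume "(u, v) \<in> perm_rels n l H"
  then obtain \<sigma> where "u \<in> lists X" "length u = l" "\<sigma> \<in> H" "v = map \<sigma> u"
    by (auto simp: perm_rels_def)
  then show "(rev u, rev v) \<in> cong"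
    using cong_map[of \<sigma> "rev u"] by (simp add: rev_map in_lists_conv_set)
qed

text \<open>
  The relations act letter by letter inside \<open>H\<close>-orbits, so every colouring of the letters that is
  constant on orbits is an invariant of words.
\<close>

lemma cong_invariant_map:
  assumes f: "\<And>\<sigma> x. \<sigma> \<in> H \<Longrightarrow> x \<in> X \<Longrightarrow> f (\<sigma> x) = f x"
    and "(u, v) \<in> cong"
  shows "map f u = map f v"
  using assms(2)
proof induction
  case (base u v)
  then show ?case using f by (auto simp: perm_rels_def in_lists_conv_set)
qed auto

lemma cong_length: "(u, v) \<in> cong \<Longrightarrow> length u = length v"
  using cong_invariant_map[of "\<lambda>_. ()" u v] map_eq_imp_length_eq by blast

abbreviation cls :: "nat list \<Rightarrow> nat list set" where
  "cls w \<equiv> cong `` {w}"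

lemma cls_eq_iff: "u \<in> lists X \<Longrightarrow> v \<in> lists X \<Longrightarrow> cls u = cls v \<longleftrightarrow> (u, v) \<in> cong"
  by (rule eq_equiv_class_iff[OF equiv_word_cong])

lemma carrier_perm_monoid: "carrier (perm_monoid n l H) = cls ` lists X"
  by (auto simp: perm_monoid_def presented_monoid_def quotient_def)

lemma monoid_perm_monoid: "monoid (perm_monoid n l H)"
  unfolding perm_monoid_def by (rule monoid_presented_monoid)

lemma one_perm_monoid: "\<one>\<^bsub>perm_monoid n l H\<^esub> = cls []"
  by (simp add: perm_monoid_def presented_monoid_def)

lemma cls_mult:
  "u \<in> lists X \<Longrightarrow> v \<in> lists X \<Longrightarrow> cls u \<otimes>\<^bsub>perm_monoid n l H\<^esub> cls v = cls (u @ v)"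
  unfolding perm_monoid_def by (rule presented_monoid_mult_class)

lemma hom_cls_map:
  assumes "g ` Y \<subseteq> X"
  shows "(\<lambda>w. cls (map g w)) \<in> hom (free_monoid Y) (perm_monoid n l H)"
proof (rule homI)
  have lists: "map g w \<in> lists X" if "w \<in> carrier (free_monoid Y)" for w
    using that assms
    by (simp only: free_monoid_def partial_object.select_convs in_lists_conv_set set_map) blast
  show "cls (map g w) \<in> carrier (perm_monoid n l H)" if "w \<in> carrier (free_monoid Y)" for w
    unfolding carrier_perm_monoid using lists[OF that] by (rule imageI)
  fix u v assume "u \<in> carrier (free_monoid Y)" "v \<in> carrier (free_monoid Y)"
  note cls_mult[OF this[THEN lists]]
  then show "cls (map g (u \<otimes>\<^bsub>free_monoid Y\<^esub> v)) =
      cls (map g u) \<otimes>\<^bsub>perm_monoid n l H\<^esub> cls (map g v)"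
    by (simp only: free_monoid_def monoid.select_convs map_append)
qed

text \<open>
  The colour \<open>f\<close> below tells the orbit of \<open>i\<close> from its complement; reading off the colours recovers
  a word over \<open>{i, j}\<close> from its class.
\<close>

lemma exponential_growth_non_transitive:
  assumes K: "field K" and "\<not> transitive_on H n"
  shows "exponential_growth K (monoid_algebra K (perm_monoid n l H))"
proof -
  let ?S = "perm_monoid n l H"
  interpret monoid_alg K ?S
    by (intro monoid_alg.intro K monoid_perm_monoid)
  obtain i j where ij: "i \<in> X" "j \<in> X" "\<And>\<sigma>. \<sigma> \<in> H \<Longrightarrow> \<sigma> i \<noteq> j"
    using assms(2) unfolding transitive_on_def by blast
  \<comment> \<open>The colouring and the two letters that carry the two colours.\<close>
  define f where "f x \<longleftrightarrow> (\<exists>\<sigma>\<in>H. \<sigma> i = x)" for x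
  define g where "g c = (if c then i else j)" for c
  have f_inv: "f (\<sigma> x) = f x" if s: "\<sigma> \<in> H" for \<sigma> x
  proof
    assume "f x"
    then show "f (\<sigma> x)" unfolding f_def using H_comp[OF s] by (metis comp_apply)
  next
    assume "f (\<sigma> x)"
    then obtain \<rho> where r: "\<rho> \<in> H" "\<rho> i = \<sigma> x" unfolding f_def by blast
    obtain \<tau> where t: "\<tau> \<in> H" "\<tau> \<circ> \<sigma> = id" using H_inverse[OF s] .
    have "(\<tau> \<circ> \<rho>) i = x" using r(2) t(2) by (metis comp_apply id_apply)
    then show "f x" unfolding f_def using H_comp[OF t(1) r(1)] by blast
  qed
  have f_g: "f (g c) = c" for c
    unfolding f_def g_def using ij(3) bexI[of "\<lambda>\<sigma>. \<sigma> i = i", OF id_apply H_id] by (cases c) auto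
  have g: "g ` UNIV \<subseteq> X" using ij unfolding g_def by (simp only: image_subset_iff split: if_split) blast
  then have map_g: "map g w \<in> lists X" for w
    by (simp only: in_lists_conv_set set_map) blast
  show ?thesis
  proof (rule exponential_growth_of_free_submonoid)
    show "finite ((\<lambda>x. cls [x]) ` X)" by simp
    show "(\<lambda>x. cls [x]) ` X \<subseteq> carrier ?S" unfolding carrier_perm_monoid by auto
    show "(\<lambda>w. cls (map g w)) \<in> hom (free_monoid UNIV) ?S" by (rule hom_cls_map[OF g])
    show "cls (map g []) = \<one>\<^bsub>?S\<^esub>" by (simp only: one_perm_monoid list.map)
    show "inj (\<lambda>w. cls (map g w))"
    proof (rule injI)
      fix u v assume "cls (map g u) = cls (map g v)"
      then have "(map g u, map g v) \<in> cong" using cls_eq_iff map_g by blast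
      then have "map f (map g u) = map f (map g v)"
        by (intro cong_invariant_map[of f] f_inv)
      then show "u = v" by (simp add: f_g comp_def)
    qed
  next
    fix F assume one: "\<one>\<^bsub>?S\<^esub> \<in> F"
      and step: "\<And>s g. s \<in> F \<Longrightarrow> g \<in> (\<lambda>x. cls [x]) ` X \<Longrightarrow> s \<otimes>\<^bsub>?S\<^esub> g \<in> F"
    have "cls w \<in> F" if "w \<in> lists X" for w
      using that
    proof (induction w rule: rev_induct)
      case Nil
      then show ?case using one by (simp only: one_perm_monoid)
    next
      case (snoc x w)
      then have w: "w \<in> lists X" "[x] \<in> lists X" and x: "x \<in> X" by auto
      show ?case using step[OF snoc.IH[OF w(1)] imageI[OF x]] cls_mult[OF w] by (simp only:)
    qed
    then show "carrier ?S \<subseteq> F" unfolding carrier_perm_monoid by blast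
  qed
qed

end

section \<open>Normal forms for semi-regular abelian groups\<close>

locale semi_regular_presentation = perm_presentation +
  assumes l_pos: "l \<ge> 1"
    and semi_regular: "semi_regular H n"
    and H_comm: "\<sigma> \<in> H \<Longrightarrow> \<tau> \<in> H \<Longrightarrow> \<sigma> \<circ> \<tau> = \<tau> \<circ> \<sigma>"
begin

definition rep :: "nat \<Rightarrow> nat" where
  "rep x = (LEAST y. \<exists>\<sigma>\<in>H. y = \<sigma> x)"

definition reps :: "nat set" where
  "reps = rep ` X"

text \<open>
  By semi-regularity the group element that takes the representative to a
  letter \<open>x\<close> is unique.
\<close>

definition charge :: "nat \<Rightarrow> nat \<Rightarrow> nat" where
  "charge x = (SOME \<sigma>. \<sigma> \<in> H \<and> \<sigma> (rep x) = x)"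

text \<open>
  The product of the charges at the positions (counted from \<open>0\<close>) congruent to \<open>k\<close> modulo \<open>l\<close>. With
  an integer index \<open>k\<close> the shift by the length of a prefix is plain subtraction.
\<close>

fun total_charge :: "nat list \<Rightarrow> int \<Rightarrow> nat \<Rightarrow> nat" where
  "total_charge [] k = id"
| "total_charge (x # w) k =
    (if int l dvd k then charge x \<circ> total_charge w (k - 1) else total_charge w (k - 1))"

lemma semi_regular_cancel:
  assumes "\<sigma> \<in> H" "\<tau> \<in> H" "x \<in> X" "\<sigma> x = \<tau> x"
  shows "\<sigma> = \<tau>"
proof -
  obtain \<tau>' where t: "\<tau>' \<in> H" "\<tau>' \<circ> \<tau> = id" "\<tau> \<circ> \<tau>' = id"
    using H_inverse[OF assms(2)] .
  have "(\<tau>' \<circ> \<sigma>) x = (\<tau>' \<circ> \<tau>) x" using assms(4) by simp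
  then have "\<tau>' \<circ> \<sigma> = id"
    using semi_regular assms(3) H_comp[OF t(1) assms(1)] t(2)
    unfolding semi_regular_def by (metis (mono_tags, lifting) id_apply mem_Collect_eq singletonD)
  then have "\<tau> \<circ> (\<tau>' \<circ> \<sigma>) = \<tau>" by simp
  then show ?thesis using t(3) by (simp flip: comp_assoc)
qed

lemma rep_orbit: "\<exists>\<sigma>\<in>H. rep x = \<sigma> x"
  unfolding rep_def by (rule LeastI2_ex[of "\<lambda>y. \<exists>\<sigma>\<in>H. y = \<sigma> x"]) (use H_id in auto)

lemma rep_invariant:
  assumes "\<sigma> \<in> H" shows "rep (\<sigma> x) = rep x"
proof -
  obtain \<tau> where t: "\<tau> \<in> H" "\<tau> \<circ> \<sigma> = id"
    using H_inverse[OF assms] .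
  have "(\<exists>\<rho>\<in>H. y = \<rho> (\<sigma> x)) \<longleftrightarrow> (\<exists>\<rho>\<in>H. y = \<rho> x)" for y
  proof
    assume "\<exists>\<rho>\<in>H. y = \<rho> (\<sigma> x)"
    then show "\<exists>\<rho>\<in>H. y = \<rho> x"
      using H_comp[OF _ assms] by (metis comp_apply)
  next
    assume "\<exists>\<rho>\<in>H. y = \<rho> x"
    then obtain \<rho> where r: "\<rho> \<in> H" "y = \<rho> x" by blast
    then have "y = (\<rho> \<circ> \<tau>) (\<sigma> x)"
      using t(2) by (metis comp_apply id_apply)
    then show "\<exists>\<rho>\<in>H. y = \<rho> (\<sigma> x)"
      using H_comp[OF r(1) t(1)] by blast
  qed
  then show ?thesis unfolding rep_def by simp
qed

lemma rep_in_X: "x \<in> X \<Longrightarrow> rep x \<in> X"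
  using rep_orbit[of x] H_mem by auto

lemma reps_subset: "reps \<subseteq> X"
  unfolding reps_def using rep_in_X by blast

lemma rep_reps: "r \<in> reps \<Longrightarrow> rep r = r"
  unfolding reps_def using rep_orbit rep_invariant by (metis imageE)

lemma charge: "charge x \<in> H" "charge x (rep x) = x"
proof -
  obtain \<sigma> where s: "\<sigma> \<in> H" "rep x = \<sigma> x" using rep_orbit by blast
  obtain \<tau> where t: "\<tau> \<in> H" "\<tau> \<circ> \<sigma> = id" using H_inverse[OF s(1)] .
  have "\<tau> \<in> H \<and> \<tau> (rep x) = x"
    using s t by (metis comp_apply id_apply)
  then have "charge x \<in> H \<and> charge x (rep x) = x"
    unfolding charge_def by (rule someI[of "\<lambda>\<sigma>. \<sigma> \<in> H \<and> \<sigma> (rep x) = x"])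
  then show "charge x \<in> H" "charge x (rep x) = x" by auto
qed

lemma charge_shift:
  assumes "\<sigma> \<in> H" "x \<in> X"
  shows "charge (\<sigma> x) = \<sigma> \<circ> charge x"
proof (rule semi_regular_cancel)
  show "charge (\<sigma> x) (rep x) = (\<sigma> \<circ> charge x) (rep x)"
    using charge(2)[of "\<sigma> x"] charge(2)[of x] rep_invariant[OF assms(1), of x] by simp
qed (use assms charge rep_in_X H_comp in auto)

lemma charge_reps: "r \<in> reps \<Longrightarrow> charge r = id"
  using semi_regular_cancel[OF charge(1) H_id, of r] charge(2)[of r] rep_reps reps_subset by auto

lemma total_charge_H: "total_charge w k \<in> H"
proof (induction w arbitrary: k)
  case Nil
  then show ?case using H_id by (simp only: total_charge.simps)
next
  case (Cons x w)
  then show ?case using H_comp charge(1) by (metis total_charge.simps(2))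
qed

lemma total_charge_append:
  "total_charge (u @ v) k = total_charge u k \<circ> total_charge v (k - int (length u))"
  by (induction u k rule: total_charge.induct) (auto simp: comp_assoc algebra_simps)

lemma total_charge_reps: "w \<in> lists reps \<Longrightarrow> total_charge w k = id"
  by (induction w k rule: total_charge.induct) (auto simp: charge_reps)

lemma total_charge_outside:
  "(\<And>j. j < length w \<Longrightarrow> \<not> int l dvd k - int j) \<Longrightarrow> total_charge w k = id"
proof (induction w arbitrary: k)
  case (Cons x w)
  have "total_charge w (k - 1) = id"
    by (rule Cons.IH) (use Cons.prems[of "Suc _"] in \<open>auto simp: algebra_simps\<close>)
  then show ?case using Cons.prems[of 0] by auto
qed simp

text \<open>
  A word of length at most \<open>l\<close> meets each residue class at most once.
\<close>

lemma total_charge_short: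
  assumes "length w \<le> l" "j < length w" "int l dvd k - int j"
  shows "total_charge w k = charge (w ! j)"
proof -
  have other: "\<not> int l dvd k - int i" if "i < length w" "i \<noteq> j" for i
  proof
    assume "int l dvd k - int i"
    then have "int l dvd (k - int i) - (k - int j)" using assms(3) by (rule dvd_diff)
    then have "int l dvd int j - int i" by simp
    then have "int l \<le> \<bar>int j - int i\<bar>"
      using that(2) by (intro zdvd_imp_le) (auto simp: dvd_abs_iff)
    then show False using that assms by auto
  qed
  have "w = take j w @ [w ! j] @ drop (Suc j) w"
    using assms(2) by (simp add: id_take_nth_drop)
  then have "total_charge w k = total_charge (take j w @ [w ! j] @ drop (Suc j) w) k"
    by simp
  also have "\<dots> = total_charge (take j w) k \<circ> (charge (w ! j) \<circ>
      total_charge (drop (Suc j) w) (k - int j - 1))"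
    using assms by (simp add: total_charge_append)
  also have "total_charge (take j w) k = id"
    by (rule total_charge_outside) (use other assms(2) in auto)
  also have "total_charge (drop (Suc j) w) (k - int j - 1) = id"
  proof (rule total_charge_outside)
    fix i assume "i < length (drop (Suc j) w)"
    then show "\<not> int l dvd k - int j - 1 - int i"
      using other[of "Suc j + i"] by (simp add: algebra_simps)
  qed
  finally show ?thesis by simp
qed

lemma total_charge_map:
  assumes "\<sigma> \<in> H" "w \<in> lists X" "length w = l"
  shows "total_charge (map \<sigma> w) k = \<sigma> \<circ> total_charge w k"
proof -
  define j where "j = nat (k mod int l)"
  have j: "j < l" "int l dvd k - int j"
    using l_pos by (auto simp: j_def nat_less_iff minus_mod_eq_mult_div)
  have "w ! j \<in> X" using assms j by (auto simp: in_lists_conv_set)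
  then show ?thesis
    using total_charge_short[of w j k] total_charge_short[of "map \<sigma> w" j k] assms j
    by (simp add: charge_shift)
qed

text \<open>
  Commutativity is needed for products of words: the factor \<open>\<tau>\<close> that comes from the second word
  must be moved past the charges of the first.
\<close>

lemma cong_total_charge:
  assumes "(u, v) \<in> cong"
  shows "\<exists>\<sigma>\<in>H. \<forall>k. total_charge v k = \<sigma> \<circ> total_charge u k"
  using assms
proof induction
  case (base u v)
  then obtain \<sigma> where "\<sigma> \<in> H" "v = map \<sigma> u" "length u = l"
    by (auto simp: perm_rels_def)
  then show ?case using total_charge_map[OF _ base.hyps(2)] by blast
next
  case (refl u)
  then show ?case using H_id by (intro bexI[of _ id]) auto
next
  case (sym u v)
  then obtain \<sigma> where s: "\<sigma> \<in> H" "\<And>k. total_charge v k = \<sigma> \<circ> total_charge u k" by blast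
  obtain \<tau> where t: "\<tau> \<in> H" "\<tau> \<circ> \<sigma> = id" using H_inverse[OF s(1)] .
  have "total_charge u k = \<tau> \<circ> total_charge v k" for k
    using s(2) t(2) by (simp flip: comp_assoc)
  then show ?case using t(1) by blast
next
  case (trans u v w)
  then obtain \<sigma> \<tau> where "\<sigma> \<in> H" "\<And>k. total_charge v k = \<sigma> \<circ> total_charge u k"
    and "\<tau> \<in> H" "\<And>k. total_charge w k = \<tau> \<circ> total_charge v k" by blast
  then show ?case using H_comp by (intro bexI[of _ "\<tau> \<circ> \<sigma>"]) (auto simp: comp_assoc)
next
  case (mult u v u' v')
  then obtain \<sigma> \<tau> where s: "\<sigma> \<in> H" "\<And>k. total_charge v k = \<sigma> \<circ> total_charge u k"
    and t: "\<tau> \<in> H" "\<And>k. total_charge v' k = \<tau> \<circ> total_charge u' k" by blast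
  have "total_charge (v @ v') k = (\<sigma> \<circ> \<tau>) \<circ> total_charge (u @ u') k" for k
  proof -
    have "total_charge (v @ v') k =
        \<sigma> \<circ> (total_charge u k \<circ> \<tau>) \<circ> total_charge u' (k - int (length u))"
      using cong_length[OF mult.hyps(1)] by (simp add: total_charge_append s t comp_assoc)
    also have "total_charge u k \<circ> \<tau> = \<tau> \<circ> total_charge u k"
      by (rule H_comm[OF total_charge_H t(1)])
    finally show ?thesis by (simp only: total_charge_append comp_assoc)
  qed
  then show ?case using H_comp[OF s(1) t(1)] by blast
qed

text \<open>
  From position \<open>l - 1\<close> on (counted from \<open>0\<close>) all letters are representatives; shorter words are
  unrestricted, since no relation applies to a word of length less than \<open>l\<close>.
\<close>

definition normal :: "nat list \<Rightarrow> bool" where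
  "normal w \<longleftrightarrow> w \<in> lists X \<and> drop (l - 1) w \<in> lists reps"

lemma total_charge_normal:
  assumes "normal w"
  shows "total_charge w k = total_charge (take (l - 1) w) k"
  using total_charge_append[of "take (l - 1) w" "drop (l - 1) w" k] assms
  by (simp add: normal_def total_charge_reps)

text \<open>
  The positions congruent to \<open>l - 1\<close> carry only representatives, and these have trivial charge.
\<close>

lemma total_charge_normal_last: "normal w \<Longrightarrow> total_charge w (int (l - 1)) = id"
  unfolding total_charge_normal
proof (rule total_charge_outside)
  fix j assume "j < length (take (l - 1) w)"
  then have "0 < int (l - 1) - int j" "int (l - 1) - int j < int l" by auto
  then show "\<not> int l dvd int (l - 1) - int j" by (rule zdvd_not_zless)
qed

text \<open>
  The class of \<open>l - 1\<close> forces the common factor \<open>\<sigma>\<close> to be trivial. Then each of the first \<open>l - 1\<close>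
  positions is alone in its class with a possibly nontrivial charge, so its charge is determined;
  together with its representative this determines the letter.
\<close>

lemma normal_unique:
  assumes "(u, v) \<in> cong" "normal u" "normal v"
  shows "u = v"
proof (rule nth_equalityI)
  show len: "length u = length v" using cong_length[OF assms(1)] .
  have "map rep u = map rep v"
    by (rule cong_invariant_map[OF rep_invariant assms(1)])
  then have rep: "rep (u ! j) = rep (v ! j)" if "j < length u" for j
    using that len by (metis nth_map)
  obtain \<sigma> where s: "\<sigma> \<in> H" "\<And>k. total_charge v k = \<sigma> \<circ> total_charge u k"
    using cong_total_charge[OF assms(1)] by blast
  have "\<sigma> = id"
    using s(2)[of "int (l - 1)"] total_charge_normal_last[OF assms(2)]
      total_charge_normal_last[OF assms(3)] by (metis comp_id)
  then have tc: "total_charge v k = total_charge u k" for k using s by simp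
  fix j assume j: "j < length u"
  have "charge (u ! j) = charge (v ! j)"
  proof (cases "j < l - 1")
    case True
    have "total_charge w (int j) = charge (w ! j)" if "normal w" "j < length w" for w
      unfolding total_charge_normal[OF that(1)]
      using total_charge_short[of "take (l - 1) w" j "int j"] True that(2) by auto
    then show ?thesis using tc[of "int j"] assms j len by metis
  next
    case False
    have "w ! j \<in> reps" if "normal w" "j < length w" for w
    proof -
      have "drop (l - 1) w ! (j - (l - 1)) \<in> set (drop (l - 1) w)"
        using that False by (intro nth_mem) auto
      then show ?thesis using that False by (auto simp: normal_def in_lists_conv_set)
    qed
    then show ?thesis using assms j len by (simp add: charge_reps)
  qed
  then show "u ! j = v ! j"
    using rep[OF j] charge(2)[of "u ! j"] charge(2)[of "v ! j"] by metis
qed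

text \<open>
  Acting on the last block turns the last letter into a representative without restricting the
  rest of the word, which is then normalised by induction.
\<close>

lemma normal_exists:
  assumes "w \<in> lists X"
  shows "\<exists>z. normal z \<and> (w, z) \<in> cong"
  using assms
proof (induction "length w" arbitrary: w)
  case 0
  then show ?case by (intro exI[of _ "[]"]) (auto simp: normal_def intro: word_cong.refl)
next
  case (Suc m)
  show ?case
  proof (cases "length w < l")
    case True
    then show ?thesis using Suc.prems
      by (intro exI[of _ w]) (auto simp: normal_def intro: word_cong.refl)
  next
    case False
    define p q where "p = take (length w - l) w" and "q = drop (length w - l) w"
    have w: "w = p @ q" and q: "length q = l" using False by (auto simp: p_def q_def)
    have pq: "p \<in> lists X" "q \<in> lists X" using Suc.prems w by auto
    have "q \<noteq> []" using q l_pos by auto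
    obtain \<sigma> where s: "\<sigma> \<in> H" "rep (last q) = \<sigma> (last q)" using rep_orbit by blast
    have "last q \<in> X"
      using \<open>q \<noteq> []\<close> pq(2) last_in_set[of q] unfolding in_lists_conv_set by blast
    then have last: "last (map \<sigma> q) \<in> reps"
      unfolding reps_def last_map[OF \<open>q \<noteq> []\<close>] s(2)[symmetric] by blast
    define y where "y = p @ butlast (map \<sigma> q)"
    have y: "p @ map \<sigma> q = y @ [last (map \<sigma> q)]"
      using \<open>q \<noteq> []\<close> by (simp add: y_def append_butlast_last_id del: map_butlast)
    have "(w, p @ map \<sigma> q) \<in> cong"
      unfolding w using pq q s by (intro word_cong.mult word_cong.refl cong_map)
    then have wy: "(w, y @ [last (map \<sigma> q)]) \<in> cong" unfolding y .
    then have yX: "y \<in> lists X" "last (map \<sigma> q) \<in> X"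
      using word_cong_lists by fastforce+
    have "length w = Suc (length y)" using cong_length[OF wy] by simp
    then obtain z where z: "normal z" "(y, z) \<in> cong"
      using Suc.hyps yX(1) by auto
    have "(y @ [last (map \<sigma> q)], z @ [last (map \<sigma> q)]) \<in> cong"
      using z yX by (intro word_cong.mult word_cong.refl) auto
    moreover have "normal (z @ [last (map \<sigma> q)])"
      using z(1) yX(2) last by (cases "l - 1 \<le> length z") (auto simp: normal_def)
    ultimately show ?thesis using wy word_cong.trans by blast
  qed
qed

text \<open>
  What is left of a normal word after its longest suffix of representatives is removed: the basis
  of \<open>S\<close> as a right act over the submonoid generated by the representatives. The reversed words
  are a basis for the left act.
\<close>

definition base_words :: "nat list set" where
  "base_words = {b \<in> lists X. length b < l \<and> (b = [] \<or> last b \<notin> reps)}"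

lemma finite_base_words: "finite base_words"
proof (rule finite_subset)
  show "base_words \<subseteq> {b. set b \<subseteq> X \<and> length b \<le> l}"
    by (auto simp: base_words_def)
qed (rule finite_lists_length_le, simp)

lemma normal_base_append:
  assumes "b \<in> base_words" "w \<in> lists reps"
  shows "normal (b @ w)"
  using assms reps_subset l_pos
  by (auto simp: normal_def base_words_def in_lists_conv_set dest: in_set_dropD)

lemma base_append_unique:
  assumes "b \<in> base_words" "b' \<in> base_words" "w \<in> lists reps" "w' \<in> lists reps"
    and "b @ w = b' @ w'"
  shows "b = b' \<and> w = w'"
proof -
  have suffix: "takeWhile (\<lambda>x. x \<in> reps) (rev (b @ w)) = rev w"
    if "b \<in> base_words" "w \<in> lists reps" for b w
  proof -
    have "takeWhile (\<lambda>x. x \<in> reps) (rev b) = []"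
      using that(1) by (cases b rule: rev_cases) (auto simp: base_words_def)
    then show ?thesis
      using that(2) by (simp add: takeWhile_append in_lists_conv_set)
  qed
  have "rev w = rev w'"
    using suffix[OF assms(1,3)] suffix[OF assms(2,4)] assms(5) by simp
  then show ?thesis using assms(5) by simp
qed

lemma normal_split:
  assumes "normal z"
  shows "\<exists>b\<in>base_words. \<exists>w\<in>lists reps. z = b @ w"
proof -
  define w where "w = rev (takeWhile (\<lambda>x. x \<in> reps) (rev z))"
  define b where "b = rev (dropWhile (\<lambda>x. x \<in> reps) (rev z))"
  have z: "z = b @ w" unfolding b_def w_def by (metis rev_append rev_rev_ident takeWhile_dropWhile_id)
  have w: "w \<in> lists reps" unfolding w_def by (auto dest: set_takeWhileD)
  have last: "last b \<notin> reps" if "b \<noteq> []"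
    using that hd_dropWhile[of "\<lambda>x. x \<in> reps" "rev z"] by (simp add: b_def last_rev)
  have "length b < l"
  proof (rule ccontr)
    assume len: "\<not> length b < l"
    then have "b \<noteq> []" using l_pos by auto
    \<comment> \<open>If \<open>b\<close> were long, normality would make its last letter a representative.\<close>
    have "drop (l - 1) z = drop (l - 1) b @ w" using z len by simp
    then have "set (drop (l - 1) b) \<subseteq> reps"
      using assms by (simp add: normal_def in_lists_conv_set subset_iff)
    moreover have "last b \<in> set (drop (l - 1) b)"
    proof -
      have "l - 1 < length b" using len l_pos by linarith
      then show ?thesis using last_in_set[of "drop (l - 1) b"] by simp
    qed
    ultimately show False using last[OF \<open>b \<noteq> []\<close>] by blast
  qed
  then have "b \<in> base_words"
    using last assms z by (auto simp: base_words_def normal_def)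
  then show ?thesis using w z by blast
qed

lemma right_decomposition:
  "bij_betw (\<lambda>(b, w). cls (b @ w)) (base_words \<times> lists reps) (carrier (perm_monoid n l H))"
proof (rule bij_betw_imageI)
  show "inj_on (\<lambda>(b, w). cls (b @ w)) (base_words \<times> lists reps)"
  proof (rule inj_onI)
    fix x y
    assume x: "x \<in> base_words \<times> lists reps" and y: "y \<in> base_words \<times> lists reps"
      and xy: "(\<lambda>(b, w). cls (b @ w)) x = (\<lambda>(b, w). cls (b @ w)) y"
    obtain b w b' w' where p: "x = (b, w)" "y = (b', w')" by fastforce
    have a: "b \<in> base_words" "w \<in> lists reps" "b' \<in> base_words" "w' \<in> lists reps"
      using x y unfolding p by blast+
    have eq: "cls (b @ w) = cls (b' @ w')" using xy unfolding p by simp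
    note N = normal_base_append[OF a(1,2)] normal_base_append[OF a(3,4)]
    have "(b @ w, b' @ w') \<in> cong"
      using eq N cls_eq_iff unfolding normal_def by blast
    then have "b = b' \<and> w = w'"
      using normal_unique[OF _ N] base_append_unique[OF a(1,3,2,4)] by blast
    then show "x = y" unfolding p by simp
  qed
  show "(\<lambda>(b, w). cls (b @ w)) ` (base_words \<times> lists reps) = carrier (perm_monoid n l H)"
  proof (intro equalityI subsetI)
    fix s assume "s \<in> carrier (perm_monoid n l H)"
    then obtain u where u: "u \<in> lists X" "s = cls u" by (auto simp: carrier_perm_monoid)
    obtain z where z: "normal z" "(u, z) \<in> cong" using normal_exists[OF u(1)] by blast
    obtain b w where "b \<in> base_words" "w \<in> lists reps" "z = b @ w"
      using normal_split[OF z(1)] by blast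
    moreover have "s = cls z" using z u cls_eq_iff[of u z] unfolding normal_def by blast
    ultimately show "s \<in> (\<lambda>(b, w). cls (b @ w)) ` (base_words \<times> lists reps)" by force
  next
    fix s assume "s \<in> (\<lambda>(b, w). cls (b @ w)) ` (base_words \<times> lists reps)"
    then obtain b w where "b \<in> base_words" "w \<in> lists reps" "s = cls (b @ w)" by force
    then show "s \<in> carrier (perm_monoid n l H)"
      using normal_base_append unfolding carrier_perm_monoid normal_def by blast
  qed
qed

text \<open>
  Reversal of words permutes the classes; it carries the factorisation \<open>b w\<close> into \<open>rev w @ rev b\<close>,
  and \<open>w\<close> may be renamed to \<open>rev w\<close>.
\<close>

lemma left_decomposition:
  "bij_betw (\<lambda>(b, w). cls (w @ rev b)) (base_words \<times> lists reps) (carrier (perm_monoid n l H))"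
proof -
  have lists_rev: "rev w \<in> lists Y \<longleftrightarrow> w \<in> lists Y" for w :: "nat list" and Y
    by (simp add: in_lists_conv_set)
  have X_rev: "rev ` lists Y = lists Y" for Y :: "nat set"
  proof (intro equalityI subsetI)
    fix w assume "w \<in> lists Y"
    then show "w \<in> rev ` lists Y"
      using lists_rev[of w Y] by (intro image_eqI[of _ _ "rev w"]) simp_all
  qed (use lists_rev in blast)
  have cls_rev: "cls (rev w) = rev ` cls w" for w
  proof (intro equalityI subsetI)
    fix v assume "v \<in> cls (rev w)"
    then have "(w, rev v) \<in> cong" using cong_rev[of "rev w" v] by simp
    then have "rev v \<in> cls w" by simp
    then have "rev (rev v) \<in> rev ` cls w" by (rule imageI)
    then show "v \<in> rev ` cls w" by simp
  next
    fix v assume "v \<in> rev ` cls w"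
    then show "v \<in> cls (rev w)" using cong_rev by auto
  qed
  have "bij_betw ((`) rev) (carrier (perm_monoid n l H)) (carrier (perm_monoid n l H))"
  proof (rule bij_betw_imageI)
    show "inj_on ((`) rev) (carrier (perm_monoid n l H))"
      by (rule inj_onI) (simp add: inj_image_eq_iff)
    have "(`) rev ` carrier (perm_monoid n l H) = cls ` rev ` lists X"
      unfolding carrier_perm_monoid image_image cls_rev ..
    then show "(`) rev ` carrier (perm_monoid n l H) = carrier (perm_monoid n l H)"
      unfolding carrier_perm_monoid X_rev .
  qed
  from bij_betw_trans[OF right_decomposition this]
  have 1: "bij_betw (\<lambda>(b, w). cls (rev w @ rev b)) (base_words \<times> lists reps)
      (carrier (perm_monoid n l H))"
    by (simp only: comp_def case_prod_unfold cls_rev[symmetric] rev_append)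
  have 2: "bij_betw (\<lambda>(b, w). (b, rev w)) (base_words \<times> lists reps) (base_words \<times> lists reps)"
    by (rule bij_betw_byWitness[where f' = "\<lambda>(b, w). (b, rev w)"]) (auto simp: in_lists_conv_set)
  show ?thesis
    using bij_betw_trans[OF 2 1]
    by (simp only: comp_def case_prod_unfold fst_conv snd_conv rev_rev_ident)
qed

section \<open>Freeness over the algebra of the representatives\<close>

text \<open>
  The letters of the free algebra are numbered by \<open>e\<close>; the homomorphism \<open>\<phi>\<close> embeds the free
  monoid as the words in the representatives. It is injective because these words are normal.
\<close>

lemma free_modules:
  assumes K: "field K"
  defines "B \<equiv> monoid_algebra K (perm_monoid n l H)"
  shows "\<exists>F. fg_free_subalgebra K B F \<and> fg_free_right_module B F \<and> fg_free_left_module B F"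
proof -
  let ?S = "perm_monoid n l H"
  interpret monoid_alg K ?S
    by (intro monoid_alg.intro K monoid_perm_monoid)
  have "finite reps" using reps_subset finite_subset by blast
  then obtain e where e: "bij_betw e {1..card reps} reps"
    using ex_bij_betw_nat_finite_1 by blast
  let ?T = "free_monoid {1..card reps}"
  define \<phi> where "\<phi> w = cls (map e w)" for w
  have T: "carrier ?T = lists {1..card reps}" "\<one>\<^bsub>?T\<^esub> = []" by (simp_all add: free_monoid_def)
  have e_reps: "map e w \<in> lists reps" if "w \<in> carrier ?T" for w
    using that bij_betw_imp_surj_on[OF e] unfolding T by (auto simp: in_lists_conv_set)
  then have e_X: "map e w \<in> lists X" if "w \<in> carrier ?T" for w
    using that reps_subset lists_mono by blast
  have "e ` {1..card reps} \<subseteq> X" using bij_betw_imp_surj_on[OF e] reps_subset by simp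
  then have hom: "\<phi> \<in> hom ?T ?S"
    unfolding \<phi>_def by (rule hom_cls_map)
  have one: "\<phi> \<one>\<^bsub>?T\<^esub> = \<one>\<^bsub>?S\<^esub>" by (simp only: \<phi>_def T one_perm_monoid list.map)
  have nil: "[] \<in> base_words" using l_pos by (simp add: base_words_def)
  have e_lists: "bij_betw (map e) (carrier ?T) (lists reps)"
    unfolding T by (rule bij_lists[OF e])
  have inj: "inj_on \<phi> (carrier ?T)"
  proof (rule inj_onI)
    fix u v assume u: "u \<in> carrier ?T" and v: "v \<in> carrier ?T" and eq: "\<phi> u = \<phi> v"
    have "normal (map e u)" "normal (map e v)"
      using normal_base_append[OF nil e_reps] u v by simp_all
    moreover have "(map e u, map e v) \<in> cong"
      using eq cls_eq_iff e_X u v unfolding \<phi>_def by blast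
    ultimately have "map e u = map e v" using normal_unique by blast
    then show "u = v" using inj_onD[OF bij_betw_imp_inj_on[OF e_lists]] u v by blast
  qed
  have base: "b \<in> lists X" "rev b \<in> lists X" if "b \<in> base_words" for b
    using that by (simp_all add: base_words_def in_lists_conv_set)
  have reindex: "bij_betw (\<lambda>(b, w). (b, map e w)) (base_words \<times> carrier ?T) (base_words \<times> lists reps)"
    using bij_betw_map_prod[OF bij_betw_id e_lists, of base_words] by (simp add: map_prod_def)
  have right: "bij_betw (\<lambda>(b, w). cls b \<otimes>\<^bsub>?S\<^esub> \<phi> w) (base_words \<times> carrier ?T) (carrier ?S)"
  proof (rule bij_betw_cong[THEN iffD1, OF _ bij_betw_trans[OF reindex right_decomposition]])
    fix x assume "x \<in> base_words \<times> carrier ?T"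
    then obtain b w where x: "x = (b, w)" "b \<in> base_words" "w \<in> carrier ?T" by blast
    show "((\<lambda>(b, w). cls (b @ w)) \<circ> (\<lambda>(b, w). (b, map e w))) x = (\<lambda>(b, w). cls b \<otimes>\<^bsub>?S\<^esub> \<phi> w) x"
      unfolding x(1) \<phi>_def comp_apply case_prod_conv cls_mult[OF base(1)[OF x(2)] e_X[OF x(3)]] ..
  qed
  have left: "bij_betw (\<lambda>(b, w). \<phi> w \<otimes>\<^bsub>?S\<^esub> cls (rev b)) (base_words \<times> carrier ?T) (carrier ?S)"
  proof (rule bij_betw_cong[THEN iffD1, OF _ bij_betw_trans[OF reindex left_decomposition]])
    fix x assume "x \<in> base_words \<times> carrier ?T"
    then obtain b w where x: "x = (b, w)" "b \<in> base_words" "w \<in> carrier ?T" by blast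
    show "((\<lambda>(b, w). cls (w @ rev b)) \<circ> (\<lambda>(b, w). (b, map e w))) x =
        (\<lambda>(b, w). \<phi> w \<otimes>\<^bsub>?S\<^esub> cls (rev b)) x"
      unfolding x(1) \<phi>_def comp_apply case_prod_conv cls_mult[OF e_X[OF x(3)] base(2)[OF x(2)]] ..
  qed
  let ?F = "supported (\<phi> ` carrier ?T)"
  have "subalg K A ?F"
  proof (rule subalg_supported)
    show "\<phi> ` carrier ?T \<subseteq> carrier ?S" using hom by (auto simp: hom_def)
    show "\<one>\<^bsub>?S\<^esub> \<in> \<phi> ` carrier ?T"
      using one monoid.one_closed[OF monoid_free_monoid] by (metis imageI)
    fix s t assume "s \<in> \<phi> ` carrier ?T" "t \<in> \<phi> ` carrier ?T"
    then obtain u v where uv: "u \<in> carrier ?T" "v \<in> carrier ?T" "s = \<phi> u" "t = \<phi> v" by blast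
    then have "s \<otimes>\<^bsub>?S\<^esub> t = \<phi> (u \<otimes>\<^bsub>?T\<^esub> v)" using hom_mult[OF hom] by metis
    then show "s \<otimes>\<^bsub>?S\<^esub> t \<in> \<phi> ` carrier ?T"
      using monoid.m_closed[OF monoid_free_monoid uv(1,2)] by (metis imageI)
  qed
  moreover have "alg_iso K (free_algebra K (card reps)) (A\<lparr>carrier := ?F\<rparr>) \<noteq> {}"
    unfolding free_algebra_def
    by (rule monoid_embedding_alg_iso[OF monoid_free_monoid hom one inj])
  ultimately have "fg_free_subalgebra K A ?F" unfolding fg_free_subalgebra_def by blast
  moreover have "fg_free_right_module A ?F"
    by (rule free_act_fg_free_right_module[OF monoid_free_monoid finite_base_words _ hom one inj right])
      (use base in \<open>auto simp only: carrier_perm_monoid\<close>)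
  moreover have "fg_free_left_module A ?F"
    by (rule free_act_fg_free_left_module[OF monoid_free_monoid finite_base_words _ hom one inj left])
      (use base in \<open>auto simp only: carrier_perm_monoid\<close>)
  ultimately show ?thesis unfolding B_def by blast
qed

end

theorem theorem3p3:
  fixes n l :: nat
    and H :: "(nat \<Rightarrow> nat) set"
    and K :: "('k, 'm) ring_scheme"
  assumes "n \<ge> 1" and "l \<ge> 2"
    and "subgroup H (sym_group n)"
    and "\<not> transitive_on H n"
    and "field K"
  shows "let A = monoid_algebra K (perm_monoid n l H) in
    exponential_growth K A \<and>
    (semi_regular H n \<and> comm_group ((sym_group n)\<lparr>carrier := H\<rparr>) \<longrightarrow>
      (\<exists>F. fg_free_subalgebra K A F \<and> fg_free_right_module A F) \<and>
      (\<exists>F. fg_free_subalgebra K A F \<and> fg_free_left_module A F))"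
proof -
  interpret perm_presentation n l H
    by (rule perm_presentation.intro) (rule assms)
  have "\<exists>F. fg_free_subalgebra K (monoid_algebra K (perm_monoid n l H)) F \<and>
      fg_free_right_module (monoid_algebra K (perm_monoid n l H)) F \<and>
      fg_free_left_module (monoid_algebra K (perm_monoid n l H)) F"
    if semi: "semi_regular H n" and comm: "comm_group ((sym_group n)\<lparr>carrier := H\<rparr>)"
  proof -
    interpret H: comm_group "(sym_group n)\<lparr>carrier := H\<rparr>" by (rule comm)
    interpret semi_regular_presentation n l H
    proof
      show "l \<ge> 1" using assms(2) by simp
      show "semi_regular H n" by (rule semi)
      show "\<sigma> \<circ> \<tau> = \<tau> \<circ> \<sigma>" if "\<sigma> \<in> H" "\<tau> \<in> H" for \<sigma> \<tau>
        using H.m_comm[of \<sigma> \<tau>] that by (simp add: sym_group_mult)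
    qed
    show ?thesis by (rule free_modules[OF assms(5)])
  qed
  then show ?thesis
    unfolding Let_def using exponential_growth_non_transitive[OF assms(5,4)] by blast
qed

end
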